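(* Let $n\ge2$, $\alpha>1$ and $\Psi(t)=t^{\frac{1-\alpha}2}$. Then $M^{\frac n2,\alpha}(\mathbb{R}^n)\hookrightarrow V_\Psi(\mathbb{R}^n)$, and this embedding is strict: $M^{\frac n2,\alpha}(\mathbb{R}^n)\ne V_\Psi(\mathbb{R}^n)$.
   Context: $\mathcal{D}(\mathbb{R}^n)=\{2^{-k}(m+[0,1)^n):k\in\mathbb{Z},m\in\mathbb{Z}^n\}$. The Morrey space $M^{p,\alpha}(\mathbb{R}^n)$ is normed by $\sup_{Q\in\mathcal{D}(\mathbb{R}^n)}(1-(\log|Q|)_-)^\alpha|Q|^{-1/p'}\int_Q|f|$, where $(a)_-=\min\{a,0\}$ and $p'$ is the dual exponent (so for $p=n/2$, $1/p'=1-2/n$). $\{\Delta_j\}_{j\in\mathbb{N}_0}$ are the standard inhomogeneous Littlewood–Paley operators and $V_\Psi(\mathbb{R}^n)$ is the set of $f\in\mathcal{S}'(\mathbb{R}^n)$ with $\|f\|_{V_\Psi}=\sup_{N\in\mathbb{N}_0}\Psi(N)^{-2}\sum_{j=N}^\infty2^{-2j}\|\Delta_jf\|_{L^\infty(\mathbb{R}^n)}<\infty$.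
   Formalization: For N=0 the weight Ψ(0)^{-2}, with Ψ(0)=0^{(1-α)/2} and a negative exponent, is undefined; it is taken to be 0 (as if Ψ(0)=∞), so the supremum defining the V_Ψ norm effectively runs over N≥1 and does not measure Δ_0 f. *)

theory Defs
  imports "HOL-Analysis.Analysis"
begin

definition pd :: "'n::finite \<Rightarrow> (real^'n \<Rightarrow> 'b::real_normed_vector) \<Rightarrow> real^'n \<Rightarrow> 'b" where
  "pd i f x = vector_derivative (\<lambda>t. f (x + t *\<^sub>R axis i 1)) (at 0)"

fun pds :: "'n::finite list \<Rightarrow> (real^'n \<Rightarrow> 'b::real_normed_vector) \<Rightarrow> real^'n \<Rightarrow> 'b" where
  "pds [] f = f"
| "pds (i # is) f = pd i (pds is f)"

definition smooth_fun :: "(real^'n::finite \<Rightarrow> 'b::real_normed_vector) \<Rightarrow> bool" where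
  "smooth_fun f \<longleftrightarrow>
     (\<forall>is i x. ((\<lambda>t. pds is f (x + t *\<^sub>R axis i 1)) has_vector_derivative pds (i # is) f x) (at 0))
   \<and> (\<forall>is. continuous_on UNIV (pds is f))"

definition schwartz_seminorm :: "nat \<Rightarrow> 'n::finite list \<Rightarrow> (real^'n \<Rightarrow> complex) \<Rightarrow> real" where
  "schwartz_seminorm k is \<phi> = (SUP x. (1 + norm x) ^ k * norm (pds is \<phi> x))"

definition schwartz :: "(real^'n::finite \<Rightarrow> complex) \<Rightarrow> bool" where
  "schwartz \<phi> \<longleftrightarrow> smooth_fun \<phi> \<and>
     (\<forall>is k. bounded (range (\<lambda>x. (1 + norm x) ^ k * norm (pds is \<phi> x))))"

text \<open>Tempered distributions: continuous linear functionals on the Schwartz space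
  (only their values on Schwartz functions are relevant).\<close>
definition tempered_distribution :: "((real^'n::finite \<Rightarrow> complex) \<Rightarrow> complex) \<Rightarrow> bool" where
  "tempered_distribution T \<longleftrightarrow>
     (\<forall>\<phi> \<theta> a b. schwartz \<phi> \<longrightarrow> schwartz \<theta> \<longrightarrow>
         T (\<lambda>x. a * \<phi> x + b * \<theta> x) = a * T \<phi> + b * T \<theta>)
   \<and> (\<exists>C N. \<forall>\<phi>. schwartz \<phi> \<longrightarrow>
         norm (T \<phi>) \<le> C * (\<Sum>k\<le>N. \<Sum>is\<in>{is::'n list. length is \<le> N}. schwartz_seminorm k is \<phi>))"

definition fun_distr :: "(real^'n::finite \<Rightarrow> complex) \<Rightarrow> (real^'n \<Rightarrow> complex) \<Rightarrow> complex" where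
  "fun_distr f = (\<lambda>\<phi>. LINT y|lborel. f y * \<phi> y)"

definition lp_generator :: "(real^'n::finite \<Rightarrow> real) \<Rightarrow> bool" where
  "lp_generator \<psi> \<longleftrightarrow> smooth_fun \<psi> \<and> (\<forall>\<xi>. 0 \<le> \<psi> \<xi> \<and> \<psi> \<xi> \<le> 1)
     \<and> (\<forall>\<xi>. norm \<xi> \<le> 1 \<longrightarrow> \<psi> \<xi> = 1) \<and> (\<forall>\<xi>. 2 < norm \<xi> \<longrightarrow> \<psi> \<xi> = 0)"

fun lp_symbol :: "(real^'n::finite \<Rightarrow> real) \<Rightarrow> nat \<Rightarrow> real^'n \<Rightarrow> real" where
  "lp_symbol \<psi> 0 \<xi> = \<psi> \<xi>"
| "lp_symbol \<psi> (Suc j) \<xi> = \<psi> (\<xi> /\<^sub>R 2 ^ Suc j) - \<psi> (\<xi> /\<^sub>R 2 ^ j)"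

text \<open>Inverse Fourier transform (normalising constant omitted; irrelevant for the statement).\<close>
definition inv_fourier :: "(real^'n::finite \<Rightarrow> real) \<Rightarrow> real^'n \<Rightarrow> complex" where
  "inv_fourier g x = (LINT \<xi>|lborel. complex_of_real (g \<xi>) * cis (x \<bullet> \<xi>))"

text \<open>Delta_j T = phi_j * T, i.e. (Delta_j T)(x) = T(phi_j(x - .)).\<close>
definition LP :: "(real^'n::finite \<Rightarrow> real) \<Rightarrow> nat \<Rightarrow> ((real^'n \<Rightarrow> complex) \<Rightarrow> complex) \<Rightarrow> real^'n \<Rightarrow> complex" where
  "LP \<psi> j T x = T (\<lambda>y. inv_fourier (lp_symbol \<psi> j) (x - y))"

definition Linf_norm :: "(real^'n::finite \<Rightarrow> complex) \<Rightarrow> ennreal" where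
  "Linf_norm g = (SUP x. ennreal (norm (g x)))"

definition V_norm :: "(nat \<Rightarrow> real) \<Rightarrow> (real^'n::finite \<Rightarrow> real) \<Rightarrow> ((real^'n \<Rightarrow> complex) \<Rightarrow> complex) \<Rightarrow> ennreal" where
  "V_norm \<Psi> \<psi> T = (SUP N::nat. ennreal (\<Psi> N powr -2) *
      (\<Sum>i. ennreal (2 powr (-2 * real (i + N))) * Linf_norm (LP \<psi> (i + N) T)))"

definition V_space :: "(nat \<Rightarrow> real) \<Rightarrow> (real^'n::finite \<Rightarrow> real) \<Rightarrow> ((real^'n \<Rightarrow> complex) \<Rightarrow> complex) set" where
  "V_space \<Psi> \<psi> = {T. tempered_distribution T \<and> V_norm \<Psi> \<psi> T < \<infinity>}"

definition dyadic_cube :: "int \<Rightarrow> ('n::finite \<Rightarrow> int) \<Rightarrow> (real^'n) set" where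
  "dyadic_cube k m = {x. \<forall>i. 2 powr (- real_of_int k) * real_of_int (m i) \<le> x $ i
                          \<and> x $ i < 2 powr (- real_of_int k) * (real_of_int (m i) + 1)}"

definition morrey_norm :: "real \<Rightarrow> real \<Rightarrow> (real^'n::finite \<Rightarrow> complex) \<Rightarrow> ennreal" where
  "morrey_norm p \<alpha> f = (SUP (k, m) \<in> UNIV.
      ennreal ((1 - min (ln (measure lborel (dyadic_cube k m))) 0) powr \<alpha>
               * measure lborel (dyadic_cube k m) powr (- (1 - 1 / p)))
      * (\<integral>\<^sup>+ x \<in> dyadic_cube k m. ennreal (norm (f x)) \<partial>lborel))"

definition morrey_space :: "real \<Rightarrow> real \<Rightarrow> (real^'n::finite \<Rightarrow> complex) set" where
  "morrey_space p \<alpha> = {f. f \<in> borel_measurable lborel \<and> morrey_norm p \<alpha> f < \<infinity>}"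

end

(* A function f is controlled only through its averages on balls: a Morrey function satisfies
     integral of |f| over B(x, 2^(l-j))  <=  m 2^(nl) (1+l)^\<alpha> 4^j 2^(-nj) (1+j)^(-\<alpha>)
   for all j, l >= 0 (cover the ball by 3^n dyadic cubes). The kernel of \<Delta>_j is
   O(2^(nj) (1 + 2^j |x|)^(-n-1)), so summing over dyadic balls gives
   2^(-2j) |\<Delta>_j f| = O(m (1+j)^(-\<alpha>)), whose tails are O(N^(1-\<alpha>)) = O(\<Psi>(N)^2).
   The constant function 1 satisfies the same ball estimate, hence lies in V_\<Psi>. It is not a Morrey
   function, since |Q|^(2/n) is unbounded over large cubes; testing against dilated bumps shows this
   at the level of distributions. *)

theory Submission
  imports Defs "HOL-Real_Asymp.Real_Asymp"
begin

text \<open>The obstacle is that a ball of radius 2^(l-j) has depth j - l, so the Morrey weight by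
  itself gains only a power of 1 + max 0 (j-l). The inequality (1+j)/(1+l) \<le> 1 + max 0 (j-l)
  separates the two indices: it yields the full gain (1+j)^(-\<alpha>) at every l, at the price
  (1+l)^\<alpha>. This price fixes the kernel decay: order n+1 against the growth 2^(nl) leaves a
  factor 2^(-l), whose sum against (1+l)^\<alpha> converges. The decay comes from n+1 integrations
  by parts, which are available because the symbols are built from a smooth compactly supported
  \<psi>. The normalisation 2^(nj) of the kernel then meets 2^(-nj) from the growth bound, and the
  remaining 4^j is what 2^(-2j) removes. Every estimate is linear in m, with factors depending only
  on n, \<alpha> and \<psi>; this is what makes the embedding continuous. The constant function fits
  because its ball integrals are V 2^(nl) 2^(-nj), with V the volume of the unit ball, and 4^j
  (1+j)^(-\<alpha>) is bounded below.\<close>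

section \<open>Iterated partial derivatives and compactly supported functions\<close>

lemma smooth_fun_continuous: "smooth_fun f \<Longrightarrow> continuous_on UNIV (pds is f)"
  by (simp add: smooth_fun_def)

text \<open>\<open>smooth_fun\<close> differentiates only at parameter 0, but at every base point.
  Moving the base point to \<open>x + s *\<^sub>R axis i 1\<close> and shifting the parameter gives
  the derivative along the whole line, as the mean value theorem requires.\<close>

lemma smooth_fun_has_vector_derivative:
  assumes "smooth_fun f"
  shows "((\<lambda>t. pds is f (x + t *\<^sub>R axis i 1)) has_vector_derivative pds (i # is) f (x + s *\<^sub>R axis i 1)) (at s)"
proof -
  have "((\<lambda>t. pds is f ((x + s *\<^sub>R axis i 1) + t *\<^sub>R axis i 1)) has_vector_derivative
      pds (i # is) f (x + s *\<^sub>R axis i 1)) (at 0)"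
    using assms unfolding smooth_fun_def by blast
  then have "((\<lambda>t. pds is f ((x + s *\<^sub>R axis i 1) + t *\<^sub>R axis i 1)) has_vector_derivative
      pds (i # is) f (x + s *\<^sub>R axis i 1)) (at (s - s))" by simp
  then have "((\<lambda>t. pds is f ((x + s *\<^sub>R axis i 1) + t *\<^sub>R axis i 1)) \<circ> (\<lambda>t. t - s) has_vector_derivative
      1 *\<^sub>R pds (i # is) f (x + s *\<^sub>R axis i 1)) (at s)"
    by (intro vector_diff_chain_at) (auto intro!: derivative_eq_intros)
  then show ?thesis by (simp add: o_def algebra_simps)
qed

text \<open>The exterior of the closed ball is open, so near an exterior point the function being
  differentiated is constantly 0. Induction on the list carries this to all orders.\<close>

lemma pds_eq_0_outside:
  assumes "smooth_fun f" "\<And>x. R < norm x \<Longrightarrow> f x = 0" "R < norm x"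
  shows "pds is f x = 0"
  using assms(3)
proof (induction "is" arbitrary: x)
  case (Cons i "is")
  have d: "((\<lambda>t. pds is f (x + t *\<^sub>R axis i 1)) has_vector_derivative pds (i # is) f x) (at 0)"
    using smooth_fun_has_vector_derivative[OF assms(1), of "is" x i 0] by simp
  have "((\<lambda>t. 0) has_vector_derivative pds (i # is) f x) (at 0)"
  proof (rule has_vector_derivative_transform_within_open[OF d])
    show "open {t. R < norm (x + t *\<^sub>R axis i 1)}"
      by (intro open_Collect_less continuous_intros)
  qed (use Cons in auto)
  then show ?case
    using vector_derivative_unique_at[OF _ has_vector_derivative_const] by blast
qed (use assms in simp)

lemma continuous_compact_support_bounded:
  fixes g :: "'a::euclidean_space \<Rightarrow> real"
  assumes "continuous_on UNIV g" "\<And>x. R < norm x \<Longrightarrow> g x = 0"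
  obtains B where "B > 0" "\<And>x. norm (g x) \<le> B"
proof -
  have "bounded (g ` cball 0 R)"
    by (intro compact_imp_bounded compact_continuous_image continuous_on_subset[OF assms(1)]) auto
  then obtain B where B: "B > 0" "\<And>y. y \<in> g ` cball 0 R \<Longrightarrow> norm y \<le> B"
    by (auto simp: bounded_pos)
  have "norm (g x) \<le> B" for x
    using B assms(2)[of x] by (cases "norm x \<le> R") auto
  with B show ?thesis using that by blast
qed

lemma continuous_compact_support_integrable_cis:
  fixes g :: "real^'n::finite \<Rightarrow> real"
  assumes "continuous_on UNIV g" "\<And>x. R < norm x \<Longrightarrow> g x = 0"
  shows "integrable lborel (\<lambda>\<xi>. complex_of_real (g \<xi>) * cis (z \<bullet> \<xi>))"
proof -
  let ?h = "\<lambda>\<xi>. complex_of_real (g \<xi>) * cis (z \<bullet> \<xi>)"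
  have "integrable lborel (\<lambda>\<xi>. indicator (cball 0 R) \<xi> *\<^sub>R ?h \<xi>)"
    by (intro borel_integrable_compact continuous_intros continuous_on_subset[OF assms(1)]) auto
  moreover have "(\<lambda>\<xi>. indicator (cball 0 R) \<xi> *\<^sub>R ?h \<xi>) = ?h"
    using assms(2) by (fastforce simp: indicator_def)
  ultimately show ?thesis by simp
qed

section \<open>Fourier integrals under translation, dilation and differentiation\<close>

lemma integral_lborel_translate:
  fixes h :: "'a::euclidean_space \<Rightarrow> complex"
  assumes "h \<in> borel_measurable borel"
  shows "(LINT x|lborel. h (x + c)) = (LINT x|lborel. h x)"
proof -
  have "(LINT x|lborel. h x) = (LINT x|distr lborel borel ((+) c). h x)"
    by (simp add: lborel_distr_plus)
  also have "\<dots> = (LINT x|lborel. h (c + x))" using assms by (intro integral_distr) auto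
  finally show ?thesis by (simp add: add.commute)
qed

lemma integral_lborel_scaleR:
  fixes h :: "'a::euclidean_space \<Rightarrow> complex"
  assumes [measurable]: "h \<in> borel_measurable borel" and c: "c > 0"
  shows "(LINT x|lborel. h x) = c ^ DIM('a) *\<^sub>R (LINT x|lborel. h (c *\<^sub>R x))"
proof -
  have "(LINT x|lborel. h x) = (LINT x|density (distr lborel borel (\<lambda>x. 0 + c *\<^sub>R x)) (\<lambda>_. ennreal (\<bar>c\<bar>^DIM('a))). h x)"
    using lborel_affine[of c "0::'a"] c by (simp add: ennreal_power)
  also have "\<dots> = (LINT x|distr lborel borel (\<lambda>x. 0 + c *\<^sub>R x). c^DIM('a) *\<^sub>R h x)"
    using c by (subst integral_density) auto
  also have "\<dots> = c ^ DIM('a) *\<^sub>R (LINT x|lborel. h (c *\<^sub>R x))"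
    by (subst integral_distr) auto
  finally show ?thesis .
qed

lemma inv_fourier_scaleR:
  assumes [measurable]: "g \<in> borel_measurable borel" and c: "c > 0"
  shows "inv_fourier (\<lambda>\<xi>::real^'n::finite. g (\<xi> /\<^sub>R c)) x = c ^ CARD('n) * inv_fourier g (c *\<^sub>R x)"
proof -
  have [measurable]: "(\<lambda>\<xi>::real^'n. \<xi> /\<^sub>R c) \<in> borel_measurable borel" "(\<lambda>\<xi>. cis (x \<bullet> \<xi>)) \<in> borel_measurable borel"
    by (intro borel_measurable_continuous_onI continuous_intros)+
  show ?thesis
    unfolding inv_fourier_def
    by (subst integral_lborel_scaleR[OF _ c], measurable) (use c in \<open>simp add: scaleR_conv_of_real[where 'a=complex]\<close>)
qed

text \<open>Integration by parts without Fubini: translating \<open>g\<close> in a coordinate direction multiplies its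
  transform by a phase, and this identity is differentiated in the translation parameter.\<close>

lemma inv_fourier_partial_derivative:
  fixes g g' :: "real^'n::finite \<Rightarrow> real"
  assumes cg: "continuous_on UNIV g" and cg': "continuous_on UNIV g'"
    and g0: "\<And>x. R < norm x \<Longrightarrow> g x = 0" and g'0: "\<And>x. R < norm x \<Longrightarrow> g' x = 0"
    and der: "\<And>x s. ((\<lambda>t. g (x + t *\<^sub>R axis i 1)) has_real_derivative g' (x + s *\<^sub>R axis i 1)) (at s)"
  shows "inv_fourier g' z = - (\<i> * z $ i) * inv_fourier g z"
proof -
  let ?e = "axis i 1 :: real^'n"
  \<comment> \<open>Dominated convergence is applied along a sequence, so the translation parameter
    runs through 1/(m+1). Being at most 1, it keeps all translated supports inside the ball of
    radius \<open>R + 1\<close>.\<close>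
  define t where "t = (\<lambda>m::nat. inverse (real (Suc m)))"
  have t: "0 < t m" "t m \<le> 1" for m by (auto simp: t_def field_simps)
  have tlim: "filterlim t (at 0) sequentially"
    unfolding filterlim_at using LIMSEQ_inverse_real_of_nat t(1)
    by (auto simp: t_def intro!: always_eventually)
  obtain M where M: "M > 0" "\<And>x. norm (g' x) \<le> M"
    using continuous_compact_support_bounded[OF cg' g'0] by blast
  have [measurable]: "g \<in> borel_measurable borel" "g' \<in> borel_measurable borel"
    using cg cg' by (auto intro: borel_measurable_continuous_onI)
  have [measurable]: "(\<lambda>\<xi>. cis (z \<bullet> \<xi>)) \<in> borel_measurable borel"
    by (intro borel_measurable_continuous_onI continuous_intros)
  define s where "s = (\<lambda>m \<xi>. complex_of_real ((g (\<xi> + t m *\<^sub>R ?e) - g \<xi>) / t m) * cis (z \<bullet> \<xi>))"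
  \<comment> \<open>The mean value theorem along the axis bounds the difference quotients by
    \<open>M\<close>, uniformly in \<open>m\<close>; this supplies the dominating function
    \<open>M\<close> on \<open>cball 0 (R + 1)\<close>.\<close>
  have quot: "\<bar>g (\<xi> + t m *\<^sub>R ?e) - g \<xi>\<bar> \<le> M * t m" for m \<xi>
  proof -
    have "\<exists>y. 0 < y \<and> y < t m \<and> g (\<xi> + t m *\<^sub>R ?e) - g (\<xi> + 0 *\<^sub>R ?e) = (t m - 0) * g' (\<xi> + y *\<^sub>R ?e)"
      by (rule MVT2) (use t der in auto)
    then obtain y where "g (\<xi> + t m *\<^sub>R ?e) - g \<xi> = t m * g' (\<xi> + y *\<^sub>R ?e)" by auto
    then have "\<bar>g (\<xi> + t m *\<^sub>R ?e) - g \<xi>\<bar> = t m * norm (g' (\<xi> + y *\<^sub>R ?e))"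
      using t(1)[of m] by (simp add: abs_mult)
    also have "\<dots> \<le> t m * M" using M t(1)[of m] by (intro mult_left_mono) auto
    finally show ?thesis by (simp add: mult.commute)
  qed
  have "(\<lambda>m. integral\<^sup>L lborel (s m)) \<longlonglongrightarrow> (LINT \<xi>|lborel. complex_of_real (g' \<xi>) * cis (z \<bullet> \<xi>))"
  proof (rule integral_dominated_convergence)
    show "integrable lborel (\<lambda>\<xi>. indicator (cball 0 (R + 1)) \<xi> *\<^sub>R M :: real)"
      by (intro borel_integrable_compact) auto
    show "AE \<xi> in lborel. (\<lambda>m. s m \<xi>) \<longlonglongrightarrow> complex_of_real (g' \<xi>) * cis (z \<bullet> \<xi>)"
    proof (intro AE_I2)
      fix \<xi>
      have "((\<lambda>h. (g (\<xi> + h *\<^sub>R ?e) - g \<xi>) / h) \<longlongrightarrow> g' \<xi>) (at 0)"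
        using der[of \<xi> 0] by (simp add: DERIV_def)
      then have "(\<lambda>m. (g (\<xi> + t m *\<^sub>R ?e) - g \<xi>) / t m) \<longlonglongrightarrow> g' \<xi>"
        using tlim by (rule filterlim_compose)
      then show "(\<lambda>m. s m \<xi>) \<longlonglongrightarrow> complex_of_real (g' \<xi>) * cis (z \<bullet> \<xi>)"
        unfolding s_def by (intro tendsto_intros)
    qed
    show "AE \<xi> in lborel. norm (s m \<xi>) \<le> indicator (cball 0 (R + 1)) \<xi> *\<^sub>R M" for m
    proof (intro AE_I2)
      fix \<xi>
      show "norm (s m \<xi>) \<le> indicator (cball 0 (R + 1)) \<xi> *\<^sub>R M"
      proof (cases "norm \<xi> \<le> R + 1")
        case True
        have "norm (s m \<xi>) = \<bar>g (\<xi> + t m *\<^sub>R ?e) - g \<xi>\<bar> / t m"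
          unfolding s_def norm_mult norm_of_real using t(1)[of m] by simp
        also have "\<dots> \<le> M" using quot[of \<xi> m] t(1)[of m] by (simp add: pos_divide_le_eq)
        finally show ?thesis using True by simp
      next
        case False
        have "norm \<xi> \<le> norm (\<xi> + t m *\<^sub>R ?e) + t m"
          using norm_triangle_ineq4[of "\<xi> + t m *\<^sub>R ?e" "t m *\<^sub>R ?e"] t(1)[of m] by simp
        then have "R < norm (\<xi> + t m *\<^sub>R ?e)" "R < norm \<xi>" using False t(2)[of m] by auto
        then show ?thesis using g0 M(1) by (simp add: s_def)
      qed
    qed
  qed (auto simp: s_def)
  moreover have "integral\<^sup>L lborel (s m) = ((cis (- (z $ i) * t m) - 1) / t m) * inv_fourier g z" for m
  proof -
    have int: "integrable lborel (\<lambda>\<xi>. complex_of_real (g \<xi>) * cis (z \<bullet> \<xi>))"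
      using continuous_compact_support_integrable_cis[OF cg g0] by blast
    \<comment> \<open>The exponential is evaluated at the untranslated point. The factor
      \<open>cis (- (z $ i) * t m)\<close> compensates for this, so that the first half of the
      quotient becomes an exact translate of \<open>h\<close>.\<close>
    define h where "h = (\<lambda>\<xi>. complex_of_real (g \<xi>) * cis (z \<bullet> \<xi>) * cis (- (z $ i) * t m))"
    have hm[measurable]: "h \<in> borel_measurable borel" unfolding h_def by measurable
    have hi: "integrable lborel h" unfolding h_def using int by (intro integrable_mult_left)
    have e: "complex_of_real (g (\<xi> + t m *\<^sub>R ?e)) * cis (z \<bullet> \<xi>) = h (\<xi> + t m *\<^sub>R ?e)" for \<xi>
      by (simp add: h_def inner_add_right inner_axis cis_mult mult.assoc algebra_simps)
    have hi': "integrable lborel (\<lambda>\<xi>. h (\<xi> + t m *\<^sub>R ?e))"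
    proof -
      have "integrable (distr lborel borel ((+) (t m *\<^sub>R ?e))) h" using hi by (simp add: lborel_distr_plus)
      then show ?thesis by (subst (asm) integrable_distr_eq) (auto simp: add.commute)
    qed
    have "integral\<^sup>L lborel (s m) = (LINT \<xi>|lborel. (h (\<xi> + t m *\<^sub>R ?e) - complex_of_real (g \<xi>) * cis (z \<bullet> \<xi>)) / t m)"
      unfolding e[symmetric] s_def by (simp add: diff_divide_distrib algebra_simps)
    also have "\<dots> = ((LINT \<xi>|lborel. h (\<xi> + t m *\<^sub>R ?e)) - inv_fourier g z) / t m"
      using hi' int by (simp add: inv_fourier_def)
    also have "(LINT \<xi>|lborel. h (\<xi> + t m *\<^sub>R ?e)) = (LINT \<xi>|lborel. h \<xi>)"
      by (rule integral_lborel_translate[OF hm])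
    also have "\<dots> = inv_fourier g z * cis (- (z $ i) * t m)"
      by (simp add: h_def inv_fourier_def)
    finally show ?thesis by (simp add: field_simps)
  qed
  moreover have "(\<lambda>m. ((cis (- (z $ i) * t m) - 1) / t m) * inv_fourier g z) \<longlonglongrightarrow> - (\<i> * z $ i) * inv_fourier g z"
  proof -
    have "((\<lambda>h. exp (- (\<i> * z $ i) * h)) has_field_derivative - (\<i> * z $ i)) (at 0)"
      by (auto intro!: derivative_eq_intros)
    then have "((\<lambda>h. (exp (- (\<i> * z $ i) * h) - 1) / h) \<longlongrightarrow> - (\<i> * z $ i)) (at 0)"
      by (simp add: DERIV_def)
    moreover have "filterlim (\<lambda>m. complex_of_real (t m)) (at 0) sequentially"
      using tlim tendsto_of_real[of t 0 sequentially, where 'a=complex] by (simp add: filterlim_at)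
    ultimately have "(\<lambda>m. (exp (- (\<i> * z $ i) * t m) - 1) / t m) \<longlonglongrightarrow> - (\<i> * z $ i)"
      by (rule filterlim_compose)
    then show ?thesis by (intro tendsto_intros) (simp add: cis_conv_exp mult_ac)
  qed
  ultimately show ?thesis
    using LIMSEQ_unique unfolding inv_fourier_def by auto
qed

lemma norm_inv_fourier_le: "norm (inv_fourier g z) \<le> (LINT \<xi>|lborel. \<bar>g \<xi>\<bar>)"
  unfolding inv_fourier_def by (rule order_trans[OF integral_norm_bound]) (simp add: norm_mult)

section \<open>Decay of the Littlewood-Paley kernels\<close>

text \<open>Taking \<open>L\<close> derivatives in direction i multiplies the transform by (-\<i>
  z_i)^L, while any transform is bounded by the L1 norm of its integrand. Since norm z \<le> n |z_i|
  for the largest coordinate, pure derivatives in the coordinate directions suffice.\<close>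

lemma inv_fourier_decay:
  fixes \<psi> :: "real^'n::finite \<Rightarrow> real"
  assumes sm: "smooth_fun \<psi>" and 0: "\<And>x. R < norm x \<Longrightarrow> \<psi> x = 0"
  obtains C where "C > 0" "\<And>z. norm (inv_fourier \<psi> z) \<le> C * (1 / (1 + norm z)^L)"
proof -
  note c = smooth_fun_continuous[OF sm] and z = pds_eq_0_outside[OF sm 0]
  have pw: "inv_fourier (pds (replicate k i) \<psi>) z = (- (\<i> * z $ i))^k * inv_fourier \<psi> z" for k i z
  proof (induction k)
    case (Suc k)
    have "inv_fourier (pds (i # replicate k i) \<psi>) z = - (\<i> * z $ i) * inv_fourier (pds (replicate k i) \<psi>) z"
      by (rule inv_fourier_partial_derivative[OF c c z z])
         (auto simp: has_real_derivative_iff_has_vector_derivative simp del: pds.simps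
           intro: smooth_fun_has_vector_derivative[OF sm])
    then show ?case using Suc by simp
  qed simp
  define B where "B = (\<lambda>i. LINT \<xi>|lborel. \<bar>pds (replicate L i) \<psi> \<xi>\<bar>)"
  define B0 where "B0 = (LINT \<xi>|lborel. \<bar>\<psi> \<xi>\<bar>)"
  have b0: "norm (inv_fourier \<psi> z) \<le> B0" for z
    unfolding B0_def by (rule norm_inv_fourier_le)
  have b: "\<bar>z $ i\<bar>^L * norm (inv_fourier \<psi> z) \<le> B i" for z i
  proof -
    have "norm (inv_fourier (pds (replicate L i) \<psi>) z) \<le> B i"
      unfolding B_def by (rule norm_inv_fourier_le)
    then show ?thesis unfolding pw by (simp add: norm_mult norm_power)
  qed
  have Bnn: "0 \<le> B i" "0 \<le> B0" for i by (auto simp: B_def B0_def)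
  let ?n = "real CARD('n)"
  \<comment> \<open>\<open>B0\<close> serves the summand 1 of 1 + n^L |z_i|^L. The index of the
    largest coordinate varies with \<open>z\<close>, so all the \<open>B i\<close> are summed. The
    final 1 only makes \<open>C\<close> strictly positive.\<close>
  define C where "C = 2^L * (B0 + ?n^L * sum B UNIV) + 1"
  have main: "(1 + norm z)^L * norm (inv_fourier \<psi> z) \<le> C" for z
  proof -
    have "\<exists>i. \<forall>k. \<bar>z $ k\<bar> \<le> \<bar>z $ i\<bar>"
      using Max_in[of "range (\<lambda>k. \<bar>z $ k\<bar>)"] Max_ge[of "range (\<lambda>k. \<bar>z $ k\<bar>)"] by fastforce
    then obtain i where i: "\<And>k. \<bar>z $ k\<bar> \<le> \<bar>z $ i\<bar>" by blast
    have "norm z \<le> (\<Sum>k\<in>UNIV. \<bar>z $ k\<bar>)" by (rule norm_le_l1_cart)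
    also have "\<dots> \<le> ?n * \<bar>z $ i\<bar>" using sum_bounded_above[of UNIV "\<lambda>k. \<bar>z $ k\<bar>", OF i] by simp
    finally have nz: "norm z \<le> ?n * \<bar>z $ i\<bar>" .
    have "(1 + norm z)^L \<le> (2 * max 1 (norm z))^L" by (intro power_mono) auto
    also have "\<dots> = 2^L * max 1 (norm z)^L" by (simp add: power_mult_distrib)
    also have "max 1 (norm z)^L \<le> 1 + (?n * \<bar>z $ i\<bar>)^L"
    proof (cases "norm z \<le> 1")
      case False
      have "norm z ^ L \<le> (?n * \<bar>z $ i\<bar>)^L" using nz by (intro power_mono) auto
      then show ?thesis using False by (simp add: max_def)
    qed (auto simp: max_def)
    finally have "(1 + norm z)^L \<le> 2^L * (1 + ?n^L * \<bar>z $ i\<bar>^L)" by (simp add: power_mult_distrib)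
    then have "(1 + norm z)^L * norm (inv_fourier \<psi> z) \<le> 2^L * (1 + ?n^L * \<bar>z $ i\<bar>^L) * norm (inv_fourier \<psi> z)"
      by (rule mult_right_mono) simp
    also have "\<dots> = 2^L * (norm (inv_fourier \<psi> z) + ?n^L * (\<bar>z $ i\<bar>^L * norm (inv_fourier \<psi> z)))"
      by (simp add: algebra_simps)
    also have "\<dots> \<le> 2^L * (B0 + ?n^L * sum B UNIV)"
    proof -
      have "B i \<le> sum B UNIV" using Bnn by (intro member_le_sum) auto
      with b[of z i] have "\<bar>z $ i\<bar>^L * norm (inv_fourier \<psi> z) \<le> sum B UNIV" by linarith
      then show ?thesis using b0[of z] by (intro mult_left_mono add_mono) auto
    qed
    finally show ?thesis by (simp add: C_def)
  qed
  have "C > 0" unfolding C_def using Bnn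
    by (intro add_nonneg_pos mult_nonneg_nonneg add_nonneg_nonneg sum_nonneg) auto
  moreover have "norm (inv_fourier \<psi> z) \<le> C * (1 / (1 + norm z)^L)" for z
  proof -
    have "(1 + norm z)^L > 0" by (simp add: add_pos_nonneg)
    then show ?thesis using main[of z] by (simp add: field_simps)
  qed
  ultimately show ?thesis using that by blast
qed

text \<open>For j \<ge> 1 the symbol is a difference of dilates of \<open>\<psi>\<close> at the
  adjacent scales 2^j and 2^(j-1), whose transforms are rescaled copies of one decaying function.
  Both are bounded separately at scale 2^j.\<close>

lemma inv_fourier_lp_symbol_decay:
  fixes \<psi> :: "real^'n::finite \<Rightarrow> real"
  assumes "lp_generator \<psi>"
  obtains C where "C > 0"
    "\<And>j z. norm (inv_fourier (lp_symbol \<psi> j) z) \<le> C * 2^(CARD('n) * j) * (1 / (1 + 2^j * norm z)^L)"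
proof -
  let ?n = "CARD('n)"
  have sm: "smooth_fun \<psi>" and 0: "\<And>x. 2 < norm x \<Longrightarrow> \<psi> x = 0" using assms by (auto simp: lp_generator_def)
  have c: "continuous_on UNIV \<psi>" using smooth_fun_continuous[OF sm, of "[]"] by simp
  have [measurable]: "\<psi> \<in> borel_measurable borel" using c by (rule borel_measurable_continuous_onI)
  obtain C where C: "C > 0" "\<And>z. norm (inv_fourier \<psi> z) \<le> C * (1 / (1 + norm z)^L)"
    using inv_fourier_decay[OF sm 0] by blast
  have dil: "norm (inv_fourier (\<lambda>\<xi>. \<psi> (\<xi> /\<^sub>R 2^k)) z) \<le> C * 2^(?n*k) * (1 / (1 + 2^k * norm z)^L)" for k z
  proof -
    have "norm (inv_fourier (\<lambda>\<xi>. \<psi> (\<xi> /\<^sub>R 2^k)) z) = 2^(?n*k) * norm (inv_fourier \<psi> (2^k *\<^sub>R z))"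
      by (subst inv_fourier_scaleR) (auto simp: norm_mult norm_power power_mult mult.commute simp flip: power_mult)
    also have "\<dots> \<le> 2^(?n*k) * (C * (1 / (1 + norm (2^k *\<^sub>R z))^L))"
      by (intro mult_left_mono C) auto
    finally show ?thesis by (simp add: mult_ac)
  qed
  have int: "integrable lborel (\<lambda>\<xi>. complex_of_real (\<psi> (\<xi> /\<^sub>R 2^k)) * cis (z \<bullet> \<xi>))" for k z
    by (rule continuous_compact_support_integrable_cis[where R = "2 * 2^k"])
       (auto intro!: continuous_on_compose2[OF c] continuous_intros 0 simp: field_simps)
  have "norm (inv_fourier (lp_symbol \<psi> j) z) \<le> (C * (1 + 2^L)) * 2^(?n * j) * (1 / (1 + 2^j * norm z)^L)" for j z
  proof (cases j)
    case 0
    have "lp_symbol \<psi> 0 = \<psi>" by (rule ext) simp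
    moreover have "C * (1 / (1 + norm z)^L) * 1 \<le> C * (1 / (1 + norm z)^L) * (1 + 2^L)"
      using C(1) by (intro mult_left_mono) auto
    ultimately show ?thesis using C(2)[of z] by (simp add: 0 mult_ac)
  next
    case (Suc k)
    have "norm (inv_fourier (lp_symbol \<psi> j) z) =
       norm (inv_fourier (\<lambda>\<xi>. \<psi> (\<xi> /\<^sub>R 2^Suc k)) z - inv_fourier (\<lambda>\<xi>. \<psi> (\<xi> /\<^sub>R 2^k)) z)"
      unfolding inv_fourier_def using int[of "Suc k" z] int[of k z]
      by (simp add: Suc left_diff_distrib flip: Bochner_Integration.integral_diff)
    also have "\<dots> \<le> C * 2^(?n*Suc k) * (1 / (1 + 2^Suc k * norm z)^L) + C * 2^(?n*k) * (1 / (1 + 2^k * norm z)^L)"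
      by (rule order_trans[OF norm_triangle_ineq4]) (intro add_mono dil)
    also have "\<dots> \<le> C * 2^(?n*Suc k) * (1 / (1 + 2^Suc k * norm z)^L) + C * 2^(?n*Suc k) * (2^L / (1 + 2^Suc k * norm z)^L)"
    proof -
      \<comment> \<open>Passing from the coarser scale to the finer one at most doubles 1 + 2^k norm
        z, which accounts for the factor 2^L.\<close>
      have "(1 + 2^Suc k * norm z)^L \<le> (2 * (1 + 2^k * norm z))^L" by (intro power_mono) auto
      then have "1 / (1 + 2^k * norm z)^L \<le> 2^L / (1 + 2^Suc k * norm z)^L"
        unfolding power_mult_distrib[of 2] by (simp add: divide_simps add_pos_nonneg mult_ac)
      moreover have "C * 2^(?n*k) \<le> C * 2^(?n*Suc k)" using C(1) by simp
      ultimately show ?thesis using C(1) by (intro add_left_mono mult_mono) auto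
    qed
    also have "\<dots> = (C * (1 + 2^L)) * 2^(?n * j) * (1 / (1 + 2^j * norm z)^L)"
      unfolding Suc by (simp add: add_divide_distrib distrib_left distrib_right)
    finally show ?thesis .
  qed
  moreover have "C * (1 + 2^L) > 0" using C(1) by (simp add: add_pos_pos)
  ultimately show ?thesis using that by blast
qed

section \<open>Elementary series estimates\<close>

text \<open>Integral comparison in telescoping form: \<open>g\<close> is the tail integral of
  t^(-\<alpha>) from i + N, and by the mean value theorem each term is at most a decrement of
  \<open>g\<close>. The condition N \<ge> 1 keeps the base positive.\<close>

lemma sum_tail_powr:
  fixes \<alpha> :: real
  assumes "\<alpha> > 1" "N \<ge> 1"
  shows "(\<Sum>i. ennreal ((1 + real (i + N)) powr - \<alpha>)) \<le> ennreal (real N powr (1 - \<alpha>) / (\<alpha> - 1))"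
proof -
  define g where "g = (\<lambda>i. real (i + N) powr (1 - \<alpha>) / (\<alpha> - 1))"
  have lim: "g \<longlonglongrightarrow> 0"
  proof -
    have "(\<lambda>i. real (i + N) powr (1 - \<alpha>)) \<longlonglongrightarrow> 0"
      using assms by (intro tendsto_neg_powr filterlim_compose[OF filterlim_real_sequentially]
          filterlim_add_const_nat_at_top) auto
    then show ?thesis unfolding g_def by (rule tendsto_divide_zero)
  qed
  have step: "(1 + real (i + N)) powr - \<alpha> \<le> g i - g (Suc i)" for i
  proof -
    let ?x = "real (i + N)"
    have x: "?x > 0" using assms by simp
    have "\<exists>z. ?x < z \<and> z < 1 + ?x \<and>
      (1 + ?x) powr (1 - \<alpha>) - ?x powr (1 - \<alpha>) = (1 + ?x - ?x) * ((1 - \<alpha>) * z powr - \<alpha>)"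
    proof (rule MVT2)
      fix y assume "?x \<le> y" "y \<le> 1 + ?x"
      then have "y > 0" using x by simp
      then show "((\<lambda>y. y powr (1 - \<alpha>)) has_real_derivative (1 - \<alpha>) * y powr - \<alpha>) (at y)"
        using has_real_derivative_powr[of y "1 - \<alpha>"] by simp
    qed simp
    then obtain z where z: "?x < z" "z < 1 + ?x"
      and e: "?x powr (1 - \<alpha>) - (1 + ?x) powr (1 - \<alpha>) = (\<alpha> - 1) * z powr - \<alpha>"
      by (auto simp: algebra_simps)
    have "g i - g (Suc i) = (?x powr (1 - \<alpha>) - (1 + ?x) powr (1 - \<alpha>)) / (\<alpha> - 1)"
      by (simp add: g_def diff_divide_distrib add_ac)
    also have "\<dots> = z powr - \<alpha>" using assms e by simp
    finally have "g i - g (Suc i) = z powr - \<alpha>" .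
    moreover have "(1 + ?x) powr - \<alpha> \<le> z powr - \<alpha>"
      using z x assms by (intro powr_mono2') auto
    ultimately show ?thesis by simp
  qed
  have s: "(\<lambda>i. g i - g (Suc i)) sums g 0"
    using telescope_sums'[OF lim] by simp
  have nn: "0 \<le> g i - g (Suc i)" for i using order_trans[OF powr_ge_zero step[of i]] .
  have "(\<Sum>i. ennreal ((1 + real (i + N)) powr - \<alpha>)) \<le> (\<Sum>i. ennreal (g i - g (Suc i)))"
    by (intro suminf_le ennreal_leI step) auto
  also have "\<dots> = ennreal (g 0)"
    by (simp only: suminf_ennreal2[OF nn sums_summable[OF s]] sums_unique[OF s, symmetric])
  finally show ?thesis by (simp add: g_def)
qed

text \<open>Writing 1/2 = (2/3)(3/4), the factor (3/4)^l eventually absorbs the power of 1 + l and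
  leaves a convergent geometric series.\<close>

lemma summable_powr_geometric:
  assumes "\<alpha> > 0"
  shows "summable (\<lambda>l. (1/2)^l * (1 + real l) powr \<alpha>)"
proof (rule summable_comparison_test_ev)
  have "((\<lambda>l. (3/4::real)^l * (1 + real l) powr \<alpha>) \<longlongrightarrow> 0) at_top" using assms by real_asymp
  then have "\<forall>\<^sub>F l in at_top. (3/4)^l * (1 + real l) powr \<alpha> < 1"
    by (rule order_tendstoD) simp
  then show "\<forall>\<^sub>F l in sequentially. norm ((1/2)^l * (1 + real l) powr \<alpha>) \<le> (2/3)^l"
  proof eventually_elim
    case (elim l)
    have "(1/2::real)^l * (1 + real l) powr \<alpha> = (2/3)^l * ((3/4)^l * (1 + real l) powr \<alpha>)"
      by (simp add: mult.assoc[symmetric] power_mult_distrib[symmetric])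
    also have "\<dots> \<le> (2/3)^l" using elim by (intro mult_left_le) auto
    finally show ?case by simp
  qed
  show "summable (\<lambda>l. (2/3::real)^l)" by (rule summable_geometric) simp
qed

text \<open>A single term already dominates: for the least \<open>l\<close> with w \<le> 2^l,
  minimality gives 2^l \<le> 2 (1 + w). The full sum has the advantage of a shape independent of
  \<open>w\<close>, ready for termwise integration.\<close>

lemma inverse_power_le_dyadic_sum:
  fixes w :: real
  assumes "w \<ge> 0"
  shows "ennreal (1 / (1 + w)^L) \<le> (\<Sum>l. ennreal (2^L * (1/2)^(l*L)) * indicator {..2^l} w)"
proof -
  have "\<exists>l. w \<le> 2^l" using real_arch_pow[of 2 w] by (auto intro: less_imp_le)
  then obtain l where l: "w \<le> 2^l" and least: "\<And>k. k < l \<Longrightarrow> \<not> w \<le> 2^k"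
    using exists_least_iff[of "\<lambda>l. w \<le> 2^l"] by blast
  have base: "2^l \<le> 2 * (1 + w)"
  proof (cases l)
    case 0 then show ?thesis using assms by simp
  next
    case (Suc k) then have "2^k < w" using least[of k] by simp
    then show ?thesis using Suc by simp
  qed
  have "2^(l*L) \<le> (2 * (1 + w))^L" using base by (subst power_mult) (intro power_mono, auto)
  then have "1 / (1 + w)^L \<le> 2^L * (1/2)^(l*L)"
    using assms unfolding power_one_over power_mult_distrib by (simp add: divide_simps mult_ac)
  then have "ennreal (1 / (1 + w)^L) \<le> ennreal (2^L * (1/2)^(l*L)) * indicator {..2^l} w"
    using l by (simp add: ennreal_leI)
  also have "\<dots> \<le> (\<Sum>l. ennreal (2^L * (1/2)^(l*L)) * indicator {..2^l} w)"
    using sum_le_suminf[OF summableI, where I="{l}"] by fastforce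
  finally show ?thesis .
qed

section \<open>The ball growth condition and its weighted integrals\<close>

text \<open>Morrey functions satisfy this with \<open>2^((n - 2) * l)\<close> in place of \<open>2^(n * l)\<close>; the weaker
  bound suffices for the convolution estimate and also admits constants.\<close>

definition ball_growth :: "real \<Rightarrow> real \<Rightarrow> (real^'n::finite \<Rightarrow> complex) \<Rightarrow> bool" where
  "ball_growth \<alpha> m f \<longleftrightarrow> (\<forall>x j l. (\<integral>\<^sup>+ y \<in> cball x (2^l / 2^j). ennreal (norm (f y)) \<partial>lborel)
     \<le> ennreal (m * (2^(CARD('n) * l) * (1 + real l) powr \<alpha>)
                * (4^j / 2^(CARD('n) * j) * (1 + real j) powr - \<alpha>)))"

text \<open>The factor 2^(n+1) comes from the dyadic majorant with L = n + 1; the series is what is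
  left of decay (1/2)^(l(n+1)) against growth 2^(nl) (1+l)^\<alpha>.\<close>

definition growth_const :: "nat \<Rightarrow> real \<Rightarrow> real" where
  "growth_const n \<alpha> = 2^(n + 1) * (\<Sum>l. (1/2)^l * (1 + real l) powr \<alpha>)"

lemma growth_const_nonneg: "\<alpha> > 0 \<Longrightarrow> 0 \<le> growth_const n \<alpha>"
  unfolding growth_const_def
  by (intro mult_nonneg_nonneg suminf_nonneg summable_powr_geometric) auto

lemma ball_growth_weighted_integral:
  fixes f :: "real^'n::finite \<Rightarrow> complex"
  assumes [measurable]: "f \<in> borel_measurable borel" and gr: "ball_growth \<alpha> m f" and m: "0 \<le> m" and \<alpha>: "\<alpha> > 0"
  shows "(\<integral>\<^sup>+ y. ennreal (norm (f y)) * ennreal (1 / (1 + 2^j * norm (x - y))^(CARD('n) + 1)) \<partial>lborel)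
     \<le> ennreal (m * growth_const CARD('n) \<alpha> * (4^j / 2^(CARD('n) * j) * (1 + real j) powr - \<alpha>))"
    (is "?I \<le> ennreal (m * _ * ?J)")
proof -
  let ?n = "CARD('n)"
  define c where "c l = (2^(?n+1) * (1/2)^(l*(?n+1)) :: real)" for l :: nat
  define b where "b l = m * (2^(?n * l) * (1 + real l) powr \<alpha>) * ?J" for l :: nat
  have c0: "0 \<le> c l" for l by (simp add: c_def)
  have b0: "0 \<le> b l" for l using m by (simp add: b_def)
  have ball: "indicator {..2^l} (2^j * norm (x - y)) = (indicator (cball x (2^l / 2^j)) y :: ennreal)" for l y
    by (auto simp: indicator_def dist_norm field_simps)
  have "?I \<le> (\<integral>\<^sup>+ y. (\<Sum>l. ennreal (c l) * (ennreal (norm (f y)) * indicator (cball x (2^l / 2^j)) y)) \<partial>lborel)"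
  proof (rule nn_integral_mono)
    fix y
    have "ennreal (norm (f y)) * ennreal (1 / (1 + 2^j * norm (x - y))^(?n + 1))
      \<le> ennreal (norm (f y)) * (\<Sum>l. ennreal (c l) * indicator {..2^l} (2^j * norm (x - y)))"
      unfolding c_def by (intro mult_left_mono inverse_power_le_dyadic_sum) auto
    also have "\<dots> = (\<Sum>l. ennreal (c l) * (ennreal (norm (f y)) * indicator (cball x (2^l / 2^j)) y))"
      by (subst ball, subst ennreal_suminf_cmult[symmetric]) (simp only: mult.left_commute)
    finally show "ennreal (norm (f y)) * ennreal (1 / (1 + 2^j * norm (x - y))^(?n + 1)) \<le> \<dots>" .
  qed
  also have "\<dots> = (\<Sum>l. ennreal (c l) * (\<integral>\<^sup>+ y \<in> cball x (2^l / 2^j). ennreal (norm (f y)) \<partial>lborel))"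
  proof -
    have [measurable]: "(indicator (cball x (2^l / 2^j)) :: real^'n \<Rightarrow> ennreal) \<in> borel_measurable borel" for l
      by (rule borel_measurable_indicator) simp
    show ?thesis
      by (subst nn_integral_suminf) (simp_all add: nn_integral_cmult)
  qed
  also have "\<dots> \<le> (\<Sum>l. ennreal (c l * b l))"
  proof (intro suminf_le)
    fix l show "ennreal (c l) * (\<integral>\<^sup>+ y \<in> cball x (2^l / 2^j). ennreal (norm (f y)) \<partial>lborel) \<le> ennreal (c l * b l)"
      using gr unfolding ball_growth_def
      by (subst ennreal_mult[OF c0 b0]) (auto simp: b_def intro!: mult_left_mono)
  qed auto
  also have "\<dots> = ennreal (m * growth_const ?n \<alpha> * ?J)"
  proof -
    have cb: "c l * b l = (m * 2^(?n+1) * ?J) * ((1/2)^l * (1 + real l) powr \<alpha>)" for l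
    proof -
      \<comment> \<open>Here the exponent n + 1 of the weight matters: one power of (1/2)^l survives
        the volume growth.\<close>
      have "(2::real)^(?n * l) * (1/2)^(?n * l + l) = (1/2)^l"
        by (simp add: power_add power_one_over mult.commute)
      moreover have "c l * b l = (m * 2^(?n+1) * ?J) * ((2^(?n * l) * (1/2)^(?n * l + l)) * (1 + real l) powr \<alpha>)"
        unfolding c_def b_def by (simp add: algebra_simps)
      ultimately show ?thesis by simp
    qed
    have "(\<Sum>l. c l * b l) = (m * 2^(?n+1) * ?J) * (\<Sum>l. (1/2)^l * (1 + real l) powr \<alpha>)"
      unfolding cb by (rule suminf_mult[OF summable_powr_geometric[OF \<alpha>]])
    moreover have "summable (\<lambda>l. c l * b l)"
      unfolding cb by (rule summable_mult[OF summable_powr_geometric[OF \<alpha>]])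
    moreover have "(\<Sum>l. ennreal (c l * b l)) = ennreal (\<Sum>l. c l * b l)"
      using calculation(2) by (intro suminf_ennreal2 mult_nonneg_nonneg c0 b0)
    moreover have "(m * 2^(?n+1) * ?J) * (\<Sum>l. (1/2)^l * (1 + real l) powr \<alpha>) = m * growth_const ?n \<alpha> * ?J"
      unfolding growth_const_def by (simp only: mult_ac)
    ultimately show ?thesis by (simp only:)
  qed
  finally show ?thesis .
qed

section \<open>Pairing with Schwartz functions and with the kernels\<close>

lemma schwartz_continuous: "schwartz \<phi> \<Longrightarrow> continuous_on UNIV \<phi>"
  using smooth_fun_continuous[of \<phi> "[]"] by (simp add: schwartz_def)

lemma schwartz_bdd_above:
  "schwartz \<phi> \<Longrightarrow> bdd_above (range (\<lambda>x. (1 + norm x) ^ k * norm (pds is \<phi> x)))"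
  by (simp add: schwartz_def bounded_imp_bdd_above)

lemma schwartz_seminorm_nonneg: "schwartz \<phi> \<Longrightarrow> 0 \<le> schwartz_seminorm k is \<phi>"
  unfolding schwartz_seminorm_def
  by (rule cSUP_upper2[where x=0, OF schwartz_bdd_above]) auto

lemma schwartz_decay:
  assumes "schwartz \<phi>"
  shows "norm (\<phi> x) \<le> schwartz_seminorm k [] \<phi> * (1 / (1 + norm x)^k)"
proof -
  have "(1 + norm x)^k * norm (pds [] \<phi> x) \<le> schwartz_seminorm k [] \<phi>"
    unfolding schwartz_seminorm_def by (rule cSUP_upper[OF _ schwartz_bdd_above[OF assms]]) simp
  moreover have "(1 + norm x)^k > 0" by (simp add: add_pos_nonneg)
  ultimately show ?thesis by (simp add: field_simps)
qed

text \<open>Used twice: with \<open>G\<close> the kernel of \<Delta>_j centred at \<open>x\<close>,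
  and, for j = 0 and x = 0, with \<open>G\<close> a Schwartz function.\<close>

lemma nn_integral_mult_le_of_growth:
  fixes f G :: "real^'n::finite \<Rightarrow> complex"
  assumes f: "f \<in> borel_measurable borel" and gr: "ball_growth \<alpha> m f" and m: "0 \<le> m" and \<alpha>: "\<alpha> > 0"
    and B: "0 \<le> B" and G: "\<And>y. norm (G y) \<le> B * (1 / (1 + 2^j * norm (x - y))^(CARD('n) + 1))"
  shows "(\<integral>\<^sup>+ y. ennreal (norm (f y * G y)) \<partial>lborel)
     \<le> ennreal (B * (m * growth_const CARD('n) \<alpha> * (4^j / 2^(CARD('n) * j) * (1 + real j) powr - \<alpha>)))"
proof -
  let ?w = "\<lambda>y. 1 / (1 + 2^j * norm (x - y))^(CARD('n) + 1)"
  have [measurable]: "f \<in> borel_measurable borel" by (rule f)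
  have "(\<integral>\<^sup>+ y. ennreal (norm (f y * G y)) \<partial>lborel)
      \<le> (\<integral>\<^sup>+ y. ennreal B * (ennreal (norm (f y)) * ennreal (?w y)) \<partial>lborel)"
  proof (rule nn_integral_mono)
    fix y
    have "norm (f y * G y) \<le> norm (f y) * (B * ?w y)"
      unfolding norm_mult by (intro mult_left_mono G) simp
    then have "ennreal (norm (f y * G y)) \<le> ennreal (B * (norm (f y) * ?w y))"
      by (intro ennreal_leI) (simp only: mult_ac)
    also have "\<dots> = ennreal B * (ennreal (norm (f y)) * ennreal (?w y))"
      using B by (simp add: ennreal_mult flip: ennreal_mult)
    finally show "ennreal (norm (f y * G y)) \<le> \<dots>" .
  qed
  also have "\<dots> = ennreal B * (\<integral>\<^sup>+ y. ennreal (norm (f y)) * ennreal (?w y) \<partial>lborel)"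
    by (rule nn_integral_cmult) measurable
  also have "\<dots> \<le> ennreal B * ennreal (m * growth_const CARD('n) \<alpha> * (4^j / 2^(CARD('n) * j) * (1 + real j) powr - \<alpha>))"
    by (intro mult_left_mono ball_growth_weighted_integral f gr m \<alpha>) auto
  also have "\<dots> = ennreal (B * (m * growth_const CARD('n) \<alpha> * (4^j / 2^(CARD('n) * j) * (1 + real j) powr - \<alpha>)))"
    using B by (simp only: ennreal_mult')
  finally show ?thesis .
qed

text \<open>Unconditional because the Bochner integral of a non-integrable function is 0 by
  convention. Bounds on \<open>LP\<close> and \<open>fun_distr\<close> thus follow directly from
  nonnegative integrals.\<close>

lemma norm_integral_le_nn_integral:
  fixes h :: "'a \<Rightarrow> 'b::{banach, second_countable_topology}"
  shows "ennreal (norm (integral\<^sup>L M h)) \<le> (\<integral>\<^sup>+ x. ennreal (norm (h x)) \<partial>M)"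
  by (cases "integrable M h") (auto simp: integral_norm_bound_ennreal not_integrable_integral_eq)

lemma tempered_distribution_fun_distr:
  fixes f :: "real^'n::finite \<Rightarrow> complex"
  assumes f: "f \<in> borel_measurable borel" and gr: "ball_growth \<alpha> m f" and m: "0 \<le> m" and \<alpha>: "\<alpha> > 0"
  shows "tempered_distribution (fun_distr f)"
proof -
  let ?L = "CARD('n) + 1"
  define C where "C = m * growth_const CARD('n) \<alpha>"
  have C: "0 \<le> C" unfolding C_def using m growth_const_nonneg[OF \<alpha>] by simp
  have bound: "(\<integral>\<^sup>+ y. ennreal (norm (f y * \<phi> y)) \<partial>lborel) \<le> ennreal (schwartz_seminorm ?L [] \<phi> * C)"
    if "schwartz \<phi>" for \<phi>
    \<comment> \<open>At j = 0 and x = 0 the weight is precisely the Schwartz decay of order n + 1,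
      with the seminorm in the role of \<open>B\<close>.\<close>
    using nn_integral_mult_le_of_growth[OF f gr m \<alpha> schwartz_seminorm_nonneg[OF that, of ?L "[]"], of \<phi> 0 0]
      schwartz_decay[OF that, of _ ?L] by (simp add: C_def)
  have int: "integrable lborel (\<lambda>y. f y * \<phi> y)" if "schwartz \<phi>" for \<phi>
  proof (rule integrableI_bounded)
    show "(\<lambda>y. f y * \<phi> y) \<in> borel_measurable lborel"
      using f borel_measurable_continuous_onI[OF schwartz_continuous[OF that]] by simp
    show "(\<integral>\<^sup>+ y. ennreal (norm (f y * \<phi> y)) \<partial>lborel) < \<infinity>"
      using order_le_less_trans[OF bound[OF that] ennreal_less_top] by simp
  qed
  have "norm (fun_distr f \<phi>) \<le> C * (\<Sum>k\<le>?L. \<Sum>is\<in>{is::'n list. length is \<le> ?L}. schwartz_seminorm k is \<phi>)"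
    if s: "schwartz \<phi>" for \<phi>
  proof -
    have fin: "finite {is::'n list. length is \<le> ?L}"
      using finite_lists_length_le[of "UNIV :: 'n set" ?L] by simp
    have "ennreal (norm (fun_distr f \<phi>)) \<le> ennreal (schwartz_seminorm ?L [] \<phi> * C)"
      unfolding fun_distr_def by (rule order_trans[OF norm_integral_le_nn_integral bound[OF s]])
    then have "norm (fun_distr f \<phi>) \<le> C * schwartz_seminorm ?L [] \<phi>"
      using C schwartz_seminorm_nonneg[OF s] by (simp add: mult.commute)
    also have "schwartz_seminorm ?L [] \<phi> \<le> (\<Sum>is\<in>{is::'n list. length is \<le> ?L}. schwartz_seminorm ?L is \<phi>)"
      using fin by (intro member_le_sum) (auto simp: schwartz_seminorm_nonneg[OF s])
    also have "\<dots> \<le> (\<Sum>k\<le>?L. \<Sum>is\<in>{is::'n list. length is \<le> ?L}. schwartz_seminorm k is \<phi>)"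
      by (rule member_le_sum) (auto intro!: sum_nonneg schwartz_seminorm_nonneg[OF s])
    finally show ?thesis using C by (simp add: mult_left_mono)
  qed
  moreover have "fun_distr f (\<lambda>x. a * \<phi> x + b * \<theta> x) = a * fun_distr f \<phi> + b * fun_distr f \<theta>"
    if "schwartz \<phi>" "schwartz \<theta>" for \<phi> \<theta> a b
  proof -
    have "f y * (a * \<phi> y + b * \<theta> y) = a * (f y * \<phi> y) + b * (f y * \<theta> y)" for y
      by (simp add: algebra_simps)
    then show ?thesis unfolding fun_distr_def using int that by simp
  qed
  ultimately show ?thesis unfolding tempered_distribution_def by blast
qed

section \<open>From ball growth to the V-norm\<close>

lemma V_norm_le:
  assumes \<alpha>: "\<alpha> > 1" and B: "0 \<le> B"
    and LP: "\<And>j. Linf_norm (LP \<psi> j T) \<le> ennreal (B * (4^j * (1 + real j) powr - \<alpha>))"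
  shows "V_norm (\<lambda>t. real t powr ((1 - \<alpha>) / 2)) \<psi> T \<le> ennreal (B / (\<alpha> - 1))"
  unfolding V_norm_def
proof (rule SUP_least)
  fix N :: nat
  show "ennreal ((real N powr ((1 - \<alpha>) / 2)) powr -2) *
      (\<Sum>i. ennreal (2 powr (-2 * real (i + N))) * Linf_norm (LP \<psi> (i + N) T)) \<le> ennreal (B / (\<alpha> - 1))"
  proof (cases "N = 0") \<comment> \<open>\<open>0 powr _ = 0\<close>, so the term \<open>N = 0\<close> vanishes\<close>
    case False
    have "(1 - \<alpha>) / 2 * - 2 = \<alpha> - 1" by (simp add: divide_simps)
    then have pp: "(real N powr ((1 - \<alpha>) / 2)) powr -2 = real N powr (\<alpha> - 1)"
      unfolding powr_powr by (rule arg_cong)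
    have p: "2 powr (-2 * real k) * 4^k = 1" for k
      by (simp add: powr_minus powr_realpow power_mult flip: powr_powr powr_realpow)
    have "(\<Sum>i. ennreal (2 powr (-2 * real (i + N))) * Linf_norm (LP \<psi> (i + N) T))
        \<le> (\<Sum>i. ennreal B * ennreal ((1 + real (i + N)) powr - \<alpha>))"
    proof (intro suminf_le)
      fix i
      have "ennreal (2 powr (-2 * real (i + N))) * Linf_norm (LP \<psi> (i + N) T)
        \<le> ennreal (2 powr (-2 * real (i + N))) * ennreal (B * (4^(i + N) * (1 + real (i + N)) powr - \<alpha>))"
        by (intro mult_left_mono LP) auto
      also have "\<dots> = ennreal ((2 powr (-2 * real (i + N)) * 4^(i + N)) * (B * (1 + real (i + N)) powr - \<alpha>))"
        by (subst ennreal_mult'[symmetric]) (simp_all only: mult_ac powr_ge_zero)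
      also have "\<dots> = ennreal B * ennreal ((1 + real (i + N)) powr - \<alpha>)"
        unfolding p using B by (simp add: ennreal_mult')
      finally show "ennreal (2 powr (-2 * real (i + N))) * Linf_norm (LP \<psi> (i + N) T) \<le> \<dots>" .
    qed auto
    also have "\<dots> \<le> ennreal B * ennreal (real N powr (1 - \<alpha>) / (\<alpha> - 1))"
      using False by (subst ennreal_suminf_cmult) (intro mult_left_mono sum_tail_powr \<alpha>, auto)
    finally have "ennreal ((real N powr ((1 - \<alpha>) / 2)) powr -2) *
        (\<Sum>i. ennreal (2 powr (-2 * real (i + N))) * Linf_norm (LP \<psi> (i + N) T))
      \<le> ennreal (real N powr (\<alpha> - 1)) * (ennreal B * ennreal (real N powr (1 - \<alpha>) / (\<alpha> - 1)))"
      unfolding pp by (intro mult_mono) auto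
    also have "\<dots> = ennreal (B / (\<alpha> - 1))"
    proof -
      have "real N powr (\<alpha> - 1) * real N powr (1 - \<alpha>) = 1"
        using False by (simp flip: powr_add)
      then have "real N powr (\<alpha> - 1) * (B * (real N powr (1 - \<alpha>) / (\<alpha> - 1))) = B / (\<alpha> - 1)"
        by (simp add: field_simps)
      then show ?thesis by (simp only: ennreal_mult'[symmetric] powr_ge_zero B)
    qed
    finally show ?thesis .
  qed simp
qed

text \<open>The constant is fixed before \<open>m\<close> and \<open>f\<close>. The same statement
  can therefore give both the continuity of the embedding and the membership of the constant
  function.\<close>

lemma V_space_of_ball_growth:
  fixes \<psi> :: "real^'n::finite \<Rightarrow> real"
  assumes \<alpha>: "\<alpha> > 1" and \<psi>: "lp_generator \<psi>"
  obtains C where "C \<ge> 0" "\<And>m f. \<lbrakk>0 \<le> m; f \<in> borel_measurable borel; ball_growth \<alpha> m f\<rbrakk> \<Longrightarrow>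
     fun_distr f \<in> V_space (\<lambda>t. real t powr ((1 - \<alpha>) / 2)) \<psi>
   \<and> V_norm (\<lambda>t. real t powr ((1 - \<alpha>) / 2)) \<psi> (fun_distr f) \<le> ennreal (C * m)"
proof -
  let ?n = "CARD('n)" and ?\<Psi> = "\<lambda>t. real t powr ((1 - \<alpha>) / 2)"
  have \<alpha>0: "\<alpha> > 0" using \<alpha> by simp
  obtain K where K: "K > 0"
    "\<And>j z. norm (inv_fourier (lp_symbol \<psi> j) z) \<le> K * 2^(?n * j) * (1 / (1 + 2^j * norm z)^(?n + 1))"
    using inv_fourier_lp_symbol_decay[OF \<psi>] by blast
  define D where "D = K * growth_const ?n \<alpha>"
  have D: "0 \<le> D" unfolding D_def using K(1) growth_const_nonneg[OF \<alpha>0] by simp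
  have main: "fun_distr f \<in> V_space ?\<Psi> \<psi> \<and> V_norm ?\<Psi> \<psi> (fun_distr f) \<le> ennreal (D / (\<alpha> - 1) * m)"
    if m: "0 \<le> m" and f: "f \<in> borel_measurable borel" and gr: "ball_growth \<alpha> m f" for m and f :: "real^'n \<Rightarrow> complex"
  proof -
    have "Linf_norm (LP \<psi> j (fun_distr f)) \<le> ennreal (D * m * (4^j * (1 + real j) powr - \<alpha>))" for j
      unfolding Linf_norm_def
    proof (rule SUP_least)
      fix x
      have "ennreal (norm (LP \<psi> j (fun_distr f) x))
          \<le> (\<integral>\<^sup>+ y. ennreal (norm (f y * inv_fourier (lp_symbol \<psi> j) (x - y))) \<partial>lborel)"
        unfolding LP_def fun_distr_def by (rule norm_integral_le_nn_integral)
      also have "\<dots> \<le> ennreal ((K * 2^(?n * j)) *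
          (m * growth_const ?n \<alpha> * (4^j / 2^(?n * j) * (1 + real j) powr - \<alpha>)))"
        using K(1) by (intro nn_integral_mult_le_of_growth[where x = x] f gr m \<alpha>0 K(2)) auto
      also have "(K * 2^(?n * j)) * (m * growth_const ?n \<alpha> * (4^j / 2^(?n * j) * (1 + real j) powr - \<alpha>))
          = D * m * (4^j * (1 + real j) powr - \<alpha>)"
        by (simp add: D_def)
      finally show "ennreal (norm (LP \<psi> j (fun_distr f) x)) \<le> \<dots>" .
    qed
    then have V: "V_norm ?\<Psi> \<psi> (fun_distr f) \<le> ennreal (D * m / (\<alpha> - 1))"
      using D m by (intro V_norm_le \<alpha>) auto
    moreover have "tempered_distribution (fun_distr f)"
      by (rule tempered_distribution_fun_distr[OF f gr m \<alpha>0])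
    ultimately show ?thesis
      using order_le_less_trans[OF V ennreal_less_top] by (simp add: V_space_def)
  qed
  have "0 \<le> D / (\<alpha> - 1)" using D \<alpha> by simp
  with main show ?thesis using that by blast
qed

section \<open>Dyadic cubes and Morrey functions\<close>

text \<open>The half-open cube lies between an open and a closed box of equal volume, which
  determines its measure.\<close>

lemma dyadic_cube_sandwich:
  fixes k :: int and m :: "'n::finite \<Rightarrow> int"
  defines "a \<equiv> (\<chi> i. 2 powr - real_of_int k * m i)" and "b \<equiv> (\<chi> i. 2 powr - real_of_int k * (m i + 1))"
  shows "box a b \<subseteq> dyadic_cube k m" "dyadic_cube k m \<subseteq> cbox a b"
  by (auto simp: dyadic_cube_def mem_box_cart a_def b_def less_imp_le)

lemma borel_measurable_dyadic_cube [measurable]: "dyadic_cube k m \<in> sets borel"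
proof -
  have "dyadic_cube k m = (\<Inter>i. {x. 2 powr - real_of_int k * m i \<le> x $ i} \<inter> {x. x $ i < 2 powr - real_of_int k * (m i + 1)})"
    by (auto simp: dyadic_cube_def)
  also have "\<dots> \<in> sets borel"
    by (intro sets.finite_INT sets.Int borel_closed borel_open closed_Collect_le open_Collect_less continuous_intros) auto
  finally show ?thesis .
qed

lemma measure_dyadic_cube:
  "measure lborel (dyadic_cube k (m :: 'n::finite \<Rightarrow> int)) = 2 powr - (real_of_int k * CARD('n))"
proof -
  let ?s = "2 powr - real_of_int k :: real"
  let ?a = "(\<chi> i. ?s * m i) :: real^'n" and ?b = "(\<chi> i. ?s * (m i + 1)) :: real^'n"
  have ab: "(?b - ?a) \<bullet> j = ?s" if "j \<in> Basis" for j
    using that by (auto simp: Basis_vec_def inner_axis algebra_simps)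
  then have le: "?a \<bullet> j \<le> ?b \<bullet> j" if "j \<in> Basis" for j
  proof -
    have "0 \<le> (?b - ?a) \<bullet> j" unfolding ab[OF that] by (rule powr_ge_zero)
    then show ?thesis by (simp only: inner_diff_left diff_ge_0_iff_ge)
  qed
  have prod: "(\<Prod>j\<in>Basis. (?b - ?a) \<bullet> j) = ?s ^ CARD('n)"
    using ab by simp
  have "emeasure lborel (dyadic_cube k m) = ennreal (?s ^ CARD('n))"
  proof (rule antisym)
    have "emeasure lborel (dyadic_cube k m) \<le> emeasure lborel (cbox ?a ?b)"
      by (intro emeasure_mono dyadic_cube_sandwich) auto
    then show "emeasure lborel (dyadic_cube k m) \<le> ennreal (?s ^ CARD('n))"
      by (simp only: emeasure_lborel_cbox[OF le] prod)
    have "emeasure lborel (box ?a ?b) \<le> emeasure lborel (dyadic_cube k m)"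
      by (intro emeasure_mono dyadic_cube_sandwich) auto
    then show "ennreal (?s ^ CARD('n)) \<le> emeasure lborel (dyadic_cube k m)"
      by (simp only: emeasure_lborel_box[OF le] prod)
  qed
  then have "measure lborel (dyadic_cube k m) = ?s ^ CARD('n)" by (simp add: measure_def)
  then show ?thesis by (simp add: powr_powr flip: powr_realpow)
qed

text \<open>Radius and side length agree, so over the ball the cube index varies by at most one in
  each coordinate: three choices per coordinate.\<close>

lemma cball_subset_dyadic_cubes:
  fixes x :: "real^'n::finite"
  obtains M :: "('n \<Rightarrow> int) set" where "finite M" "card M = 3 ^ CARD('n)"
    "cball x (2 powr - real_of_int k) \<subseteq> (\<Union>m\<in>M. dyadic_cube k m)"
proof -
  let ?r = "2 powr - real_of_int k :: real"
  have r: "?r > 0" by simp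
  have aux: "a / s - 1 \<le> b / s \<and> b / s \<le> a / s + 1" if "s > 0" "\<bar>a - b\<bar> \<le> s" for a b s :: real
    using that divide_right_mono[of "a - s" b s] divide_right_mono[of b "a + s" s]
    by (simp add: diff_divide_distrib add_divide_distrib abs_le_iff)
  define M where "M = (\<Pi>\<^sub>E i\<in>UNIV. {\<lfloor>x $ i / ?r\<rfloor> - 1 .. \<lfloor>x $ i / ?r\<rfloor> + 1})"
  have "finite M" unfolding M_def by (rule finite_PiE) auto
  moreover have "card M = 3 ^ CARD('n)" unfolding M_def by (simp add: card_PiE)
  moreover have "y \<in> (\<Union>m\<in>M. dyadic_cube k m)" if "y \<in> cball x ?r" for y
  proof
    define m where "m = (\<lambda>i. \<lfloor>y $ i / ?r\<rfloor>)"
    show "m \<in> M"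
    proof -
      have "m i \<in> {\<lfloor>x $ i / ?r\<rfloor> - 1 .. \<lfloor>x $ i / ?r\<rfloor> + 1}" for i
      proof -
        have "\<bar>(x - y) $ i\<bar> \<le> ?r"
          using that component_le_norm_cart[of "x - y" i] by (simp add: dist_norm)
        then have "x $ i / ?r - 1 \<le> y $ i / ?r" "y $ i / ?r \<le> x $ i / ?r + 1"
          using aux[OF r] by simp_all
        then show ?thesis unfolding m_def by (auto simp: le_floor_iff) linarith+
      qed
      then show ?thesis by (simp add: M_def PiE_UNIV_domain)
    qed
    have "?r * real_of_int (m i) \<le> y $ i \<and> y $ i < ?r * (real_of_int (m i) + 1)" for i
    proof -
      have "real_of_int (m i) \<le> y $ i / ?r" "y $ i / ?r < real_of_int (m i) + 1"
        unfolding m_def by linarith+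
      then show ?thesis using r by (simp add: field_simps)
    qed
    then show "y \<in> dyadic_cube k m" by (simp add: dyadic_cube_def)
  qed
  ultimately show ?thesis using that by blast
qed

text \<open>With |Q| = 2^(-kn) and p = n/2, the factor |Q|^(-1/p') equals 2^(k(n-2)), and the
  logarithmic base is 1 + k n ln 2 for k \<ge> 0 and 1 otherwise. The bound is the norm divided by
  the lower bound \<open>d\<close> of this weight.\<close>

lemma morrey_dyadic_cube_bound:
  fixes f :: "real^'n::finite \<Rightarrow> complex"
  assumes n: "CARD('n) \<ge> 2" and \<alpha>: "\<alpha> > 0" and f: "f \<in> morrey_space (real CARD('n) / 2) \<alpha>"
  shows "(\<integral>\<^sup>+ y \<in> dyadic_cube k m. ennreal (norm (f y)) \<partial>lborel)
    \<le> ennreal (enn2real (morrey_norm (real CARD('n) / 2) \<alpha> f)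
          * ((1 + max 0 (real_of_int k)) powr - \<alpha> * 2 powr - (real_of_int k * (real CARD('n) - 2))))"
proof -
  let ?n = "real CARD('n)" and ?k = "real_of_int k" and ?Q = "measure lborel (dyadic_cube k m)"
  let ?I = "\<integral>\<^sup>+ y \<in> dyadic_cube k m. ennreal (norm (f y)) \<partial>lborel"
  let ?N = "morrey_norm (?n / 2) \<alpha> f"
  have fin: "?N < \<infinity>" using f by (simp add: morrey_space_def)
  define d where "d = (1 + max 0 ?k) powr \<alpha> * 2 powr (?k * (?n - 2))"
  have d: "d > 0" unfolding d_def by (intro mult_pos_pos) auto
  have "d \<le> (1 - min (ln ?Q) 0) powr \<alpha> * ?Q powr (- (1 - 1 / (?n / 2)))"
    unfolding d_def
  proof (intro mult_mono)
    \<comment> \<open>This allows n ln 2 to be replaced by 1 in the logarithm without a constant; it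
      rests on n \<ge> 2.\<close>
    have ln2: "1 \<le> ?n * ln 2"
    proof -
      have "1 \<le> 2 * ln (2::real)" using ln2_ge_two_thirds by simp
      also have "\<dots> \<le> ?n * ln 2" using n by (intro mult_right_mono) auto
      finally show ?thesis .
    qed
    have "ln ?Q = - (?k * (?n * ln 2))" by (simp add: measure_dyadic_cube ln_powr)
    moreover have "?k \<le> ?k * (?n * ln 2)" if "?k \<ge> 0"
      using mult_left_mono[OF ln2 that] by simp
    ultimately have "1 + max 0 ?k \<le> 1 - min (ln ?Q) 0" by (auto simp: max_def min_def)
    then show "(1 + max 0 ?k) powr \<alpha> \<le> (1 - min (ln ?Q) 0) powr \<alpha>"
      using \<alpha> by (intro powr_mono2) auto
    have "- (?k * ?n) * (- (1 - 1 / (?n / 2))) = ?k * (?n - 2)"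
      using n by (simp add: field_simps)
    then show "2 powr (?k * (?n - 2)) \<le> ?Q powr (- (1 - 1 / (?n / 2)))"
      by (simp only: measure_dyadic_cube powr_powr)
  qed auto
  then have "ennreal d * ?I \<le> ennreal ((1 - min (ln ?Q) 0) powr \<alpha> * ?Q powr (- (1 - 1 / (?n / 2)))) * ?I"
    by (intro mult_right_mono ennreal_leI) auto
  also have "\<dots> \<le> ?N"
    unfolding morrey_norm_def by (rule SUP_upper2[of "(k, m)"]) auto
  also have "\<dots> = ennreal (enn2real ?N)" using fin by simp
  finally have "ennreal (1 / d) * (ennreal d * ?I) \<le> ennreal (1 / d) * ennreal (enn2real ?N)"
    by (rule mult_left_mono) simp
  moreover have "ennreal (1 / d) * (ennreal d * ?I) = ?I"
    using d by (simp add: mult.assoc[symmetric] flip: ennreal_mult)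
  moreover have "1 / d = (1 + max 0 ?k) powr - \<alpha> * 2 powr - (?k * (?n - 2))"
    unfolding d_def powr_minus by (simp add: divide_inverse)
  ultimately show ?thesis using d by (simp add: mult.commute flip: ennreal_mult)
qed

text \<open>Keeps the sharp exponent n - 2 and admits negative \<open>k\<close>, that is, large
  balls: exactly there constants violate it.\<close>

lemma morrey_cball_bound:
  fixes f :: "real^'n::finite \<Rightarrow> complex"
  assumes n: "CARD('n) \<ge> 2" and \<alpha>: "\<alpha> > 0" and f: "f \<in> morrey_space (real CARD('n) / 2) \<alpha>"
  shows "(\<integral>\<^sup>+ y \<in> cball x (2 powr - real_of_int k). ennreal (norm (f y)) \<partial>lborel)
    \<le> ennreal (3 ^ CARD('n) * enn2real (morrey_norm (real CARD('n) / 2) \<alpha> f)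
          * ((1 + max 0 (real_of_int k)) powr - \<alpha> * 2 powr - (real_of_int k * (real CARD('n) - 2))))"
    (is "?I \<le> ennreal (3 ^ CARD('n) * ?N * ?c)")
proof -
  have [measurable]: "f \<in> borel_measurable borel" using f by (simp add: morrey_space_def)
  obtain M :: "('n \<Rightarrow> int) set" where M: "finite M" "card M = 3 ^ CARD('n)"
    "cball x (2 powr - real_of_int k) \<subseteq> (\<Union>m\<in>M. dyadic_cube k m)"
    using cball_subset_dyadic_cubes by blast
  have "?I \<le> (\<integral>\<^sup>+ y. (\<Sum>m\<in>M. ennreal (norm (f y)) * indicator (dyadic_cube k m) y) \<partial>lborel)"
  proof (rule nn_integral_mono)
    fix y
    show "ennreal (norm (f y)) * indicator (cball x (2 powr - real_of_int k)) y
        \<le> (\<Sum>m\<in>M. ennreal (norm (f y)) * indicator (dyadic_cube k m) y)"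
    proof (cases "y \<in> cball x (2 powr - real_of_int k)")
      case True
      then obtain m where m: "m \<in> M" "y \<in> dyadic_cube k m" using M(3) by blast
      have "ennreal (norm (f y)) * indicator (dyadic_cube k m) y
          \<le> (\<Sum>m\<in>M. ennreal (norm (f y)) * indicator (dyadic_cube k m) y)"
        using M(1) m(1) by (intro member_le_sum) auto
      then show ?thesis using True m(2) by simp
    qed simp
  qed
  also have "\<dots> = (\<Sum>m\<in>M. \<integral>\<^sup>+ y \<in> dyadic_cube k m. ennreal (norm (f y)) \<partial>lborel)"
    by (rule nn_integral_sum) measurable
  also have "\<dots> \<le> (\<Sum>m\<in>M. ennreal (?N * ?c))"
    by (intro sum_mono morrey_dyadic_cube_bound n \<alpha> f)
  also have "\<dots> = ennreal (3 ^ CARD('n) * ?N * ?c)"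
    by (simp add: M(2) ennreal_of_nat_eq_real_of_nat mult.assoc flip: ennreal_mult)
  finally show ?thesis .
qed

lemma ball_growth_morrey:
  fixes f :: "real^'n::finite \<Rightarrow> complex"
  assumes n: "CARD('n) \<ge> 2" and \<alpha>: "\<alpha> > 0" and f: "f \<in> morrey_space (real CARD('n) / 2) \<alpha>"
  shows "ball_growth \<alpha> (3 ^ CARD('n) * enn2real (morrey_norm (real CARD('n) / 2) \<alpha> f)) f"
  unfolding ball_growth_def
proof (intro allI)
  fix x :: "real^'n" and j l :: nat
  let ?n = "real CARD('n)" and ?N = "enn2real (morrey_norm (real CARD('n) / 2) \<alpha> f)"
  define k where "k = int j - int l"
  have "2^l / 2^j = (2 powr - real_of_int k :: real)"
    by (simp add: k_def powr_diff powr_realpow)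
  then have "(\<integral>\<^sup>+ y \<in> cball x (2^l / 2^j). ennreal (norm (f y)) \<partial>lborel)
    \<le> ennreal (3 ^ CARD('n) * ?N * ((1 + max 0 (real_of_int k)) powr - \<alpha> * 2 powr - (real_of_int k * (?n - 2))))"
    using morrey_cball_bound[OF n \<alpha> f] by simp
  also have "\<dots> \<le> ennreal (3 ^ CARD('n) * ?N * (((1 + real l) powr \<alpha> * (1 + real j) powr - \<alpha>)
       * (2 ^ (CARD('n) * l) * (4^j / 2 ^ (CARD('n) * j)))))"
  proof (intro ennreal_leI mult_left_mono mult_mono)
    \<comment> \<open>Equivalent to 1 + j \<le> (1 + l)(1 + max 0 (j - l)); this separates
      \<open>j\<close> from \<open>l\<close> in the logarithmic factor.\<close>
    have "(1 + real j) / (1 + real l) \<le> 1 + max 0 (real_of_int k)"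
      by (auto simp: k_def max_def field_simps intro: mult_right_mono)
    then have "(1 + max 0 (real_of_int k)) powr - \<alpha> \<le> ((1 + real j) / (1 + real l)) powr - \<alpha>"
      using \<alpha> by (intro powr_mono2') auto
    also have "\<dots> = (1 + real l) powr \<alpha> * (1 + real j) powr - \<alpha>"
      by (simp add: powr_divide powr_minus field_simps)
    finally show "(1 + max 0 (real_of_int k)) powr - \<alpha> \<le> \<dots>" .
    \<comment> \<open>Expanding gives l(n-2) + 2j - nj; the term -2l is given away, which is the
      weakening from 2^((n-2)l) to 2^(nl).\<close>
    have "2 powr - (real_of_int k * (?n - 2)) \<le> 2 powr (?n * real l + (2 * real j - ?n * real j))"
      by (simp add: k_def algebra_simps)
    also have "\<dots> = 2 powr real (CARD('n) * l) * (2 powr real (2 * j) / 2 powr real (CARD('n) * j))"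
      by (simp add: powr_add powr_diff)
    also have "\<dots> = 2 ^ (CARD('n) * l) * (4^j / 2 ^ (CARD('n) * j))"
      unfolding powr_realpow[OF zero_less_numeral] by (simp add: power_mult)
    finally show "2 powr - (real_of_int k * (?n - 2)) \<le> \<dots>" .
  qed auto
  finally show "(\<integral>\<^sup>+ y \<in> cball x (2^l / 2^j). ennreal (norm (f y)) \<partial>lborel)
     \<le> ennreal (3 ^ CARD('n) * ?N * (2^(CARD('n) * l) * (1 + real l) powr \<alpha>)
                * (4^j / 2^(CARD('n) * j) * (1 + real j) powr - \<alpha>))"
    by (simp only: mult_ac)
qed

section \<open>Strictness: the constant function\<close>

lemma ball_growth_const:
  assumes \<alpha>: "\<alpha> > 0"
  obtains m where "0 \<le> m" "ball_growth \<alpha> m (\<lambda>_::real^'n::finite. 1)"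
proof -
  let ?V = "unit_ball_vol (real CARD('n))"
  have "(\<lambda>j. (1 + real j) powr \<alpha> / 4^j) \<longlonglongrightarrow> 0" using \<alpha> by real_asymp
  then have "Bseq (\<lambda>j. (1 + real j) powr \<alpha> / 4^j)" by (intro convergent_imp_Bseq convergentI)
  \<comment> \<open>An upper bound for (1+j)^\<alpha> / 4^j is a lower bound 1/K for 4^j
    (1+j)^(-\<alpha>), the only factor by which the volume could exceed the growth bound.\<close>
  then obtain K where K: "K > 0" "\<And>j. norm ((1 + real j) powr \<alpha> / 4^j) \<le> K" by (auto simp: Bseq_def)
  have K': "1 \<le> K * (4^j * (1 + real j) powr - \<alpha>)" for j
    using K(2)[of j] by (simp add: powr_minus field_simps)
  have "ball_growth \<alpha> (?V * K) (\<lambda>_::real^'n. 1)"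
    unfolding ball_growth_def
  proof (intro allI)
    fix x :: "real^'n" and j l :: nat
    have "(\<integral>\<^sup>+ y \<in> cball x (2^l / 2^j). ennreal (norm (1::complex)) \<partial>lborel) = ennreal (?V * (2^l / 2^j) ^ CARD('n))"
      by (simp add: emeasure_cball)
    also have "\<dots> \<le> ennreal (?V * ((2^l / 2^j) ^ CARD('n) * ((1 + real l) powr \<alpha> * (K * (4^j * (1 + real j) powr - \<alpha>)))))"
    proof (intro ennreal_leI mult_left_mono)
      have "1 * 1 \<le> (1 + real l) powr \<alpha> * (K * (4^j * (1 + real j) powr - \<alpha>))"
        using \<alpha> by (intro mult_mono K' ge_one_powr_ge_zero) auto
      then have "(2^l / 2^j) ^ CARD('n) * 1 \<le> (2^l / 2^j) ^ CARD('n) * ((1 + real l) powr \<alpha> * (K * (4^j * (1 + real j) powr - \<alpha>)))"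
        by (intro mult_left_mono) auto
      then show "(2^l / 2^j) ^ CARD('n) \<le> (2^l / 2^j) ^ CARD('n) * ((1 + real l) powr \<alpha> * (K * (4^j * (1 + real j) powr - \<alpha>)))"
        by simp
    qed auto
    also have "(2^l / 2^j :: real) ^ CARD('n) = 2^(CARD('n) * l) / 2^(CARD('n) * j)"
      by (simp add: power_divide mult.commute flip: power_mult)
    finally show "(\<integral>\<^sup>+ y \<in> cball x (2^l / 2^j). ennreal (norm (1::complex)) \<partial>lborel)
       \<le> ennreal (?V * K * (2^(CARD('n) * l) * (1 + real l) powr \<alpha>)
                  * (4^j / 2^(CARD('n) * j) * (1 + real j) powr - \<alpha>))"
      by (simp add: mult_ac)
  qed
  moreover have "0 \<le> ?V * K" using K(1) by simp
  ultimately show ?thesis using that by blast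
qed

lemma schwartz_dilated_bump:
  fixes \<psi> :: "real^'n::finite \<Rightarrow> real"
  assumes sm: "smooth_fun \<psi>" and 0: "\<And>x. R < norm x \<Longrightarrow> \<psi> x = 0" and c: "c > 0"
  shows "schwartz (\<lambda>x. complex_of_real (\<psi> (c *\<^sub>R x)))"
proof -
  \<comment> \<open>Closed form of all iterated derivatives: each differentiation contributes one
    factor \<open>c\<close>. Compact support then bounds every weighted derivative.\<close>
  let ?P = "\<lambda>is x. complex_of_real (c ^ length is * pds is \<psi> (c *\<^sub>R x))"
  have der: "((\<lambda>t. ?P is (x + t *\<^sub>R axis i 1)) has_vector_derivative ?P (i # is) x) (at 0)" for "is" i x
  proof -
    have "((\<lambda>t. pds is \<psi> (c *\<^sub>R x + t *\<^sub>R axis i 1)) \<circ> (\<lambda>t. c * t) has_vector_derivative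
        c *\<^sub>R pds (i # is) \<psi> (c *\<^sub>R x)) (at 0)"
      using smooth_fun_has_vector_derivative[OF sm, of "is" "c *\<^sub>R x" i 0]
      by (intro vector_diff_chain_at) (auto intro!: derivative_eq_intros simp del: pds.simps)
    then have "((\<lambda>t. c ^ length is * pds is \<psi> (c *\<^sub>R (x + t *\<^sub>R axis i 1))) has_vector_derivative
        c ^ length is * (c * pds (i # is) \<psi> (c *\<^sub>R x))) (at 0)"
      by (intro has_vector_derivative_mult_right) (simp add: o_def scaleR_add_right del: pds.simps)
    from has_vector_derivative_of_real[OF has_real_derivative_iff_has_vector_derivative[THEN iffD2, OF this]] show ?thesis by (simp add: mult_ac del: pds.simps)
  qed
  have pds_eq: "pds is (\<lambda>x. complex_of_real (\<psi> (c *\<^sub>R x))) = ?P is" for "is"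
  proof (induction "is")
    case (Cons i "is")
    show ?case
    proof
      fix x
      show "pds (i # is) (\<lambda>x. complex_of_real (\<psi> (c *\<^sub>R x))) x = ?P (i # is) x"
        unfolding pds.simps(2)[of i "is" "\<lambda>x. complex_of_real (\<psi> (c *\<^sub>R x))"] Cons.IH pd_def[of i "?P is"]
        by (rule vector_derivative_at[OF der])
    qed
  qed simp
  have cont: "continuous_on UNIV (?P is)" for "is"
    by (intro continuous_intros continuous_on_compose2[OF smooth_fun_continuous[OF sm]]) auto
  have "bounded (range (\<lambda>x. (1 + norm x) ^ k * norm (?P is x)))" for k "is"
  proof -
    have "continuous_on UNIV (\<lambda>x. (1 + norm x) ^ k * norm (?P is x))"
      by (intro continuous_on_mult continuous_on_norm cont continuous_intros)
    moreover have "(1 + norm x) ^ k * norm (?P is x) = 0" if "R / c < norm x" for x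
      using pds_eq_0_outside[OF sm 0, where x = "c *\<^sub>R x"] that c by (simp add: field_simps)
    ultimately obtain B where "\<And>x. norm ((1 + norm x) ^ k * norm (?P is x)) \<le> B"
      using continuous_compact_support_bounded[of "\<lambda>x. (1 + norm x) ^ k * norm (?P is x)" "R / c"] by blast
    then show ?thesis by (intro boundedI) blast
  qed
  then show ?thesis
    unfolding schwartz_def smooth_fun_def pds_eq using der cont by blast
qed

text \<open>\<open>\<psi>\<close> itself is the bump, being 1 on the unit ball and 0 beyond radius
  2. Against its dilate by 2^l the constant yields at least V 2^(nl), a Morrey function at most N
  2^((l+1)(n-2)); the ratio grows like 4^l.\<close>

lemma const_not_morrey:
  fixes \<psi> :: "real^'n::finite \<Rightarrow> real" and f :: "real^'n \<Rightarrow> complex"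
  assumes n: "CARD('n) \<ge> 2" and \<alpha>: "\<alpha> > 0" and \<psi>: "lp_generator \<psi>"
    and f: "f \<in> morrey_space (real CARD('n) / 2) \<alpha>"
    and eq: "\<And>\<phi>. schwartz \<phi> \<Longrightarrow> fun_distr (\<lambda>_. 1) \<phi> = fun_distr f \<phi>"
  shows False
proof -
  let ?n = "CARD('n)" and ?V = "unit_ball_vol (real CARD('n))"
  define N where "N = 3 ^ ?n * enn2real (morrey_norm (real CARD('n) / 2) \<alpha> f)"
  have N: "0 \<le> N" by (simp add: N_def)
  have sm: "smooth_fun \<psi>" and 0: "\<And>x. 2 < norm x \<Longrightarrow> \<psi> x = 0"
    and 1: "\<And>x. norm x \<le> 1 \<Longrightarrow> \<psi> x = 1" and r: "\<And>x. 0 \<le> \<psi> x" "\<And>x. \<psi> x \<le> 1"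
    using \<psi> by (auto simp: lp_generator_def)
  have c: "continuous_on UNIV \<psi>" using smooth_fun_continuous[OF sm, of "[]"] by simp
  have "4^l * ?V \<le> N * 2 ^ (?n - 2)" for l
  proof -
    define \<phi> where "\<phi> = (\<lambda>x. complex_of_real (\<psi> (inverse (2^l) *\<^sub>R x)))"
    have s: "schwartz \<phi>" unfolding \<phi>_def by (rule schwartz_dilated_bump[OF sm 0]) auto
    have \<phi>0: "\<phi> x = 0" if "2 * 2^l < norm x" for x
      unfolding \<phi>_def using 0[of "inverse (2^l) *\<^sub>R x"] that by (simp add: field_simps)
    have cd: "continuous_on UNIV (\<lambda>x. \<psi> (inverse (2^l) *\<^sub>R x))"
      by (intro continuous_on_compose2[OF c] continuous_intros) auto
    have int: "integrable lborel (\<lambda>x. \<psi> (inverse (2^l) *\<^sub>R x))"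
    proof -
      have "\<psi> (inverse (2^l) *\<^sub>R x) = 0" if "2 * 2^l < norm x" for x
        using 0[of "inverse (2^l) *\<^sub>R x"] that by (simp add: field_simps)
      from continuous_compact_support_integrable_cis[where R = "2 * 2^l" and z = 0, OF cd this] show ?thesis
        by (simp add: complex_of_real_integrable_eq)
    qed
    have "?V * (2^l) ^ ?n = (LINT x|lborel. indicator (cball 0 (2^l) :: (real^'n) set) x)"
      using content_cball[of "2^l" "0::real^'n"] by simp
    also have "\<dots> \<le> (LINT x|lborel. \<psi> (inverse (2^l) *\<^sub>R x))"
    proof (intro integral_mono int)
      show "integrable lborel (indicator (cball 0 (2^l) :: (real^'n) set) :: _ \<Rightarrow> real)"
        by (rule integrable_real_indicator) (use emeasure_bounded_finite[OF bounded_cball, of "0::real^'n" "2^l"] in auto)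
      show "indicator (cball 0 (2^l)) x \<le> \<psi> (inverse (2^l) *\<^sub>R x)" for x
        using r(1) 1[of "inverse (2^l) *\<^sub>R x"] by (auto simp: indicator_def field_simps)
    qed
    also have "\<dots> = norm (fun_distr (\<lambda>_. 1) \<phi>)"
      unfolding fun_distr_def \<phi>_def using r by (simp add: integral_nonneg_AE)
    also have "\<dots> = norm (fun_distr f \<phi>)" using eq[OF s] by simp
    finally have "ennreal (?V * (2^l) ^ ?n) \<le> ennreal (norm (fun_distr f \<phi>))" by (rule ennreal_leI)
    also have "\<dots> \<le> (\<integral>\<^sup>+ y. ennreal (norm (f y * \<phi> y)) \<partial>lborel)"
      unfolding fun_distr_def by (rule norm_integral_le_nn_integral)
    also have "\<dots> \<le> (\<integral>\<^sup>+ y \<in> cball 0 (2 * 2^l). ennreal (norm (f y)) \<partial>lborel)"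
    proof (rule nn_integral_mono)
      fix y
      have "norm (\<phi> y) \<le> 1" unfolding \<phi>_def using r by simp
      then have "norm (f y * \<phi> y) \<le> norm (f y)" unfolding norm_mult by (intro mult_left_le) auto
      then show "ennreal (norm (f y * \<phi> y)) \<le> ennreal (norm (f y)) * indicator (cball 0 (2 * 2^l)) y"
        using \<phi>0[of y] by (cases "norm y \<le> 2 * 2^l") (auto intro: ennreal_leI)
    qed
    \<comment> \<open>The scale index is -(l+1), hence negative: the logarithmic factor is 1 and
      only the power of the radius remains.\<close>
    also have "(2 * 2^l :: real) = 2 powr - real_of_int (- int (Suc l))"
      by (simp add: powr_add powr_realpow)
    also have "(\<integral>\<^sup>+ y \<in> cball 0 (2 powr - real_of_int (- int (Suc l))). ennreal (norm (f y)) \<partial>lborel)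
       \<le> ennreal (N * ((1 + max 0 (real_of_int (- int (Suc l)))) powr - \<alpha> * 2 powr - (real_of_int (- int (Suc l)) * (real ?n - 2))))"
      unfolding N_def by (rule morrey_cball_bound[OF n \<alpha> f])
    also have "(1 + max 0 (real_of_int (- int (Suc l)))) powr - \<alpha> * 2 powr - (real_of_int (- int (Suc l)) * (real ?n - 2))
        = 2 powr real (Suc l * (?n - 2))"
    proof -
      have "- (real_of_int (- int (Suc l)) * (real ?n - 2)) = real (Suc l * (?n - 2))"
        unfolding of_nat_mult of_nat_diff[OF n] by (simp add: algebra_simps)
      then show ?thesis by (simp only:) simp
    qed
    also have "\<dots> = 2 ^ (?n - 2) * (2^l) ^ (?n - 2)"
      by (subst powr_realpow) (simp_all add: power_add flip: power_mult)
    finally have "?V * (2^l) ^ ?n \<le> N * (2 ^ (?n - 2) * (2^l) ^ (?n - 2))"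
      using N by simp
    moreover have "(2^l :: real) ^ ?n = 4^l * (2^l) ^ (?n - 2)"
    proof -
      have "(2^l :: real) ^ ?n = (2^l) ^ (2 + (?n - 2))" by (simp only: le_add_diff_inverse[OF n])
      also have "\<dots> = (2^2)^l * (2^l) ^ (?n - 2)"
        unfolding power_add by (simp only: mult.commute flip: power_mult)
      finally show ?thesis by simp
    qed
    ultimately have "(4^l * ?V) * (2^l) ^ (?n - 2) \<le> (N * 2 ^ (?n - 2)) * (2^l) ^ (?n - 2)"
      by (simp add: mult_ac)
    then show ?thesis by (rule mult_right_le_imp_le) simp
  qed
  moreover obtain l where "N * 2 ^ (?n - 2) / ?V < 4 ^ l" using real_arch_pow[of 4] by auto
  ultimately show False
    using pos_divide_less_eq[of ?V "N * 2 ^ (?n - 2)" "4^l"] by (simp add: not_less[symmetric])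
qed

text \<open>Strictness compares \<open>T\<close> and \<open>fun_distr f\<close> on Schwartz
  functions only: functionals here are total, and a difference outside that space would say nothing
  about distributions.\<close>

theorem theorem7p5:
  fixes \<alpha> :: real and \<Psi> :: "nat \<Rightarrow> real" and \<psi> :: "real^'n::finite \<Rightarrow> real"
  assumes "CARD('n) \<ge> 2"
    and "\<alpha> > 1"
    and "\<Psi> = (\<lambda>t. real t powr ((1 - \<alpha>) / 2))"
    and "lp_generator \<psi>"
  shows "(\<exists>C. \<forall>f \<in> morrey_space (real CARD('n) / 2) \<alpha>.
            fun_distr f \<in> V_space \<Psi> \<psi>
          \<and> V_norm \<Psi> \<psi> (fun_distr f) \<le> ennreal C * morrey_norm (real CARD('n) / 2) \<alpha> f)
       \<and> (\<exists>T \<in> V_space \<Psi> \<psi>. \<not> (\<exists>f \<in> morrey_space (real CARD('n) / 2) \<alpha>.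
            \<forall>\<phi>. schwartz \<phi> \<longrightarrow> T \<phi> = fun_distr f \<phi>))"
proof -
  let ?n = "real CARD('n)"
  have \<alpha>0: "\<alpha> > 0" using assms(2) by simp
  obtain C where C: "C \<ge> 0" "\<And>m f. \<lbrakk>0 \<le> m; f \<in> borel_measurable borel; ball_growth \<alpha> m f\<rbrakk> \<Longrightarrow>
     fun_distr f \<in> V_space \<Psi> \<psi> \<and> V_norm \<Psi> \<psi> (fun_distr f) \<le> ennreal (C * m)"
    using V_space_of_ball_growth[OF assms(2,4)] unfolding assms(3) by blast
  have "fun_distr f \<in> V_space \<Psi> \<psi>
      \<and> V_norm \<Psi> \<psi> (fun_distr f) \<le> ennreal (C * 3 ^ CARD('n)) * morrey_norm (?n / 2) \<alpha> f"
    if f: "f \<in> morrey_space (?n / 2) \<alpha>" for f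
  proof -
    let ?N = "enn2real (morrey_norm (?n / 2) \<alpha> f)"
    have "fun_distr f \<in> V_space \<Psi> \<psi>
        \<and> V_norm \<Psi> \<psi> (fun_distr f) \<le> ennreal (C * (3 ^ CARD('n) * ?N))"
      using f by (intro C(2) ball_growth_morrey assms(1) \<alpha>0) (auto simp: morrey_space_def)
    moreover have "ennreal (C * (3 ^ CARD('n) * ?N)) = ennreal (C * 3 ^ CARD('n)) * ennreal ?N"
      using C(1) by (simp add: mult.assoc flip: ennreal_mult)
    \<comment> \<open>Membership in the Morrey space makes the norm finite, so the passage through
      \<open>enn2real\<close> loses nothing.\<close>
    moreover have "ennreal ?N = morrey_norm (?n / 2) \<alpha> f" using f by (simp add: morrey_space_def)
    ultimately show ?thesis by simp
  qed
  moreover obtain m where "0 \<le> m" "ball_growth \<alpha> m (\<lambda>_::real^'n. 1)"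
    using ball_growth_const[OF \<alpha>0] by blast
  then have "fun_distr (\<lambda>_. 1) \<in> V_space \<Psi> \<psi>"
    using C(2)[of m "\<lambda>_. 1"] by simp
  moreover have "\<not> (\<exists>f \<in> morrey_space (?n / 2) \<alpha>. \<forall>\<phi>::real^'n \<Rightarrow> complex. schwartz \<phi> \<longrightarrow> fun_distr (\<lambda>_. 1) \<phi> = fun_distr f \<phi>)"
    using const_not_morrey[OF assms(1) \<alpha>0 assms(4)] by blast
  ultimately show ?thesis by blast
qed

end
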